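(* Let $p$ be an odd prime. Then $$\sum_{k=0}^{\frac{p-1}2}\frac{\binom{2k}k^2}{32^k}\equiv\begin{cases}0\pmod{p^2}&\text{if }4\mid p-3,\\ 2a-\frac{p}{2a}\pmod{p^2}&\text{if }4\mid p-1\text{ and }p=a^2+b^2\text{ with }a,b\in\mathbb Z,\ 4\mid a-1.\end{cases}$$
   Context: Congruences are between rational numbers whose denominators are prime to $p$. *)

theory Defs
  imports "HOL-Number_Theory.Number_Theory"
begin

text \<open>Congruence of rationals modulo an integer m: x - y = m * (c / d) with d coprime to m,
  i.e. x and y are congruent in the ring of rationals whose denominators are prime to m.\<close>
definition rat_cong :: "rat \<Rightarrow> rat \<Rightarrow> int \<Rightarrow> bool" where
  "rat_cong x y m \<longleftrightarrow> (\<exists>c d::int. d \<noteq> 0 \<and> coprime d m \<and> x - y = of_int m * (of_int c / of_int d))"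

end

theory Submission
  imports Defs "HOL-Computational_Algebra.Polynomial"
begin

text \<open>
  For \<open>n = (p - 1) / 2\<close> one has \<open>(n + k choose 2 k) (-16)^k \<equiv> (2 k choose k)\<close> modulo \<open>p\<^sup>2\<close>, so the
  sum is congruent to the value \<open>P\<^sub>n(0)\<close> of the Legendre polynomial. It vanishes for odd \<open>n\<close>, and
  for \<open>n = 2 m\<close> it equals \<open>(-1)^m C / 4^m\<close> with \<open>C = (2 m choose m)\<close>.

  In the latter case \<open>C\<close> is evaluated modulo \<open>p\<^sup>2\<close> (Chowla, Dwork and Evans) through the Jacobsthal
  sum \<open>S = \<Sum>\<^sub>x \<chi>(x\<^sup>3 - x)\<close> of quadratic characters, which is \<open>\<plusminus>2 a\<close>. Modulo \<open>p\<^sup>2\<close>, \<open>S\<close> is the sum of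
  \<open>(t (t\<^sup>2 - 1))^(p n)\<close> over the \<open>(p - 1)\<close>-st roots of unity \<open>t\<close> modulo \<open>p\<^sup>2\<close>. Expanding the power
  leaves the coefficients \<open>(p n choose j)\<close> with \<open>j \<equiv> m\<close> modulo \<open>n\<close>. The one with
  \<open>j = p m\<close> contributes \<open>C\<close>, and the others, divisible by \<open>p\<close>, sum up to an alternating harmonic sum
  (the Fermat quotient of \<open>2\<close>) and to \<open>p / C\<close>.
\<close>

subsection \<open>Character sums\<close>

text \<open>Roots of unity replace ordinary residues because their power sums are congruent to 0 or
  p - 1 modulo p^2, whereas for ordinary residues this is guaranteed only modulo p.

  The size of S is not computed directly. Averaging the squares of the sums over all twists x^3 - k
  x gives S^2 + T^2 = 4 p, where T belongs to a non-square k. So S/2 is the odd entry of a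
  representation of p as a sum of two squares, which is unique up to sign, and S modulo 8 settles
  the sign.

  The correction terms fit together through w = (-1)^m 4^m, which satisfies w^2 = 2^(p-1) and w = 1
  modulo p. The Fermat quotient changes C into C (2 - w), and this is C / w modulo p^2, exactly the
  value of the Legendre polynomial at 0. Hence no Fermat quotient survives. Since C is 2 a modulo p,
  the remaining p / C may be replaced by p / (2 a).\<close>

lemma sum_residues_reindex:
  fixes f :: "int \<Rightarrow> 'a::comm_monoid_add" and m :: int
  assumes m: "m > 0"
    and f: "\<And>x y. [x = y] (mod m) \<Longrightarrow> f x = f y"
    and g: "\<And>x y. [g x = g y] (mod m) \<Longrightarrow> [x = y] (mod m)"
  shows "(\<Sum>x\<in>{0..<m}. f (g x)) = (\<Sum>x\<in>{0..<m}. f x)"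
proof -
  have inj: "inj_on (\<lambda>x. g x mod m) {0..<m}"
  proof (rule inj_onI)
    fix x y assume xy: "x \<in> {0..<m}" "y \<in> {0..<m}" and eq: "g x mod m = g y mod m"
    have "[x = y] (mod m)" by (rule g) (simp add: cong_def eq)
    with xy show "x = y" by (simp add: cong_def)
  qed
  have "(\<lambda>x. g x mod m) ` {0..<m} = {0..<m}"
    by (rule card_subset_eq) (use m in \<open>auto simp: card_image[OF inj]\<close>)
  hence "bij_betw (\<lambda>x. g x mod m) {0..<m} {0..<m}"
    using inj by (simp add: bij_betw_def)
  hence "(\<Sum>x\<in>{0..<m}. f (g x mod m)) = (\<Sum>x\<in>{0..<m}. f x)"
    by (rule sum.reindex_bij_betw)
  moreover have "f (g x mod m) = f (g x)" for x
    by (rule f) (simp add: cong_def)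
  ultimately show ?thesis by simp
qed

lemma sum_residues_shift:
  fixes f :: "int \<Rightarrow> 'a::comm_monoid_add" and m :: int
  assumes "m > 0" and "\<And>x y. [x = y] (mod m) \<Longrightarrow> f x = f y"
  shows "(\<Sum>x\<in>{0..<m}. f (x + c)) = (\<Sum>x\<in>{0..<m}. f x)"
  using assms by (intro sum_residues_reindex) (simp_all add: cong_add_rcancel)

lemma sum_residues_mult:
  fixes f :: "int \<Rightarrow> 'a::comm_monoid_add" and m :: int
  assumes "m > 0" and "coprime c m" and "\<And>x y. [x = y] (mod m) \<Longrightarrow> f x = f y"
  shows "(\<Sum>x\<in>{0..<m}. f (c * x)) = (\<Sum>x\<in>{0..<m}. f x)"
  using assms by (intro sum_residues_reindex) (simp_all add: cong_mult_lcancel coprime_commute)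

section \<open>The quadratic character modulo an odd prime\<close>

locale odd_prime =
  fixes p :: nat
  assumes prime: "prime p" and gt_2: "2 < p"
begin

abbreviation \<chi> :: "int \<Rightarrow> int" where "\<chi> x \<equiv> Legendre x (int p)"

lemma p_pos [simp]: "p > 0" and p_gt_1: "p > 1" "int p > 1"
  using gt_2 by auto

lemma odd_p: "odd p"
  using prime gt_2 prime_odd_nat by blast

lemma prime_int: "prime (int p)"
  using prime by simp

lemma euler: "[\<chi> x = x ^ ((p - 1) div 2)] (mod int p)"
  by (rule euler_criterion[OF prime gt_2])

lemma coprime_iff: "coprime x (int p) \<longleftrightarrow> \<not> int p dvd x"
  by (metis coprime_commute prime_imp_coprime_int prime_int coprime_absorb_left not_prime_unit)

lemma chi_cases: "\<chi> x = 0 \<or> \<chi> x = 1 \<or> \<chi> x = -1"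
  by (auto simp: Legendre_def)

lemma chi_eq_0_iff: "\<chi> x = 0 \<longleftrightarrow> int p dvd x"
  by (auto simp: Legendre_def cong_0_iff)

text \<open>Euler's criterion yields only congruences; integers between -1 and 1 differ by at most 2
  < \<open>p\<close>, so such congruences become equalities of character values.\<close>

lemma eq_if_cong_small:
  assumes "[x = y] (mod int p)" "\<bar>x\<bar> \<le> 1" "\<bar>y\<bar> \<le> 1"
  shows "x = y"
proof -
  have "int p dvd x - y" using assms by (simp add: cong_iff_dvd_diff)
  moreover have "\<bar>x - y\<bar> < int p" using assms gt_2 by linarith
  ultimately show ?thesis by (metis dvd_imp_le_int eq_iff_diff_eq_0 not_le abs_of_nat)
qed

lemma chi_abs_le: "\<bar>\<chi> x\<bar> \<le> 1"
  using chi_cases[of x] by auto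

lemma chi_cong: "[x = y] (mod int p) \<Longrightarrow> \<chi> x = \<chi> y"
  by (rule eq_if_cong_small[OF _ chi_abs_le chi_abs_le])
     (meson euler cong_pow cong_sym cong_trans)

lemma chi_mult: "\<chi> (x * y) = \<chi> x * \<chi> y"
proof (rule eq_if_cong_small[OF _ chi_abs_le])
  have "[\<chi> (x * y) = (x * y) ^ ((p - 1) div 2)] (mod int p)" by (rule euler)
  also have "(x * y) ^ ((p - 1) div 2) = x ^ ((p - 1) div 2) * y ^ ((p - 1) div 2)"
    by (rule power_mult_distrib)
  also have "[\<dots> = \<chi> x * \<chi> y] (mod int p)"
    by (intro cong_mult euler[THEN cong_sym])
  finally show "[\<chi> (x * y) = \<chi> x * \<chi> y] (mod int p)" .
  show "\<bar>\<chi> x * \<chi> y\<bar> \<le> 1"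
    using chi_cases[of x] chi_cases[of y] by auto
qed

lemma chi_1 [simp]: "\<chi> 1 = 1"
  by (rule eq_if_cong_small[OF _ chi_abs_le]) (use euler[of 1] in auto)

lemma chi_power: "\<chi> (x ^ k) = \<chi> x ^ k"
  by (induction k) (simp_all add: chi_mult)

lemma chi_square: "\<not> int p dvd x \<Longrightarrow> \<chi> x * \<chi> x = 1"
  using chi_cases[of x] chi_eq_0_iff[of x] by auto

lemma chi_eq_1_imp_square: "\<chi> k = 1 \<Longrightarrow> \<exists>t. [t\<^sup>2 = k] (mod int p)"
  by (auto simp: Legendre_def QuadRes_def split: if_splits)

lemma ex_primroot: "\<exists>g. residue_primroot p g"
  using prime_primitive_root_exists[of p] prime p_gt_1 by auto

lemma sum_residues_primroot:
  fixes f :: "int \<Rightarrow> 'a::comm_monoid_add"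
  assumes g: "residue_primroot p g"
    and f: "\<And>x y. [x = y] (mod int p) \<Longrightarrow> f x = f y"
  shows "(\<Sum>x\<in>{0..<int p}. f x) = f 0 + (\<Sum>j<p - 1. f (int g ^ j))"
proof -
  have "bij_betw (\<lambda>i. g ^ i mod p) {..<p - 1} {0<..<p}"
    using residue_primroot_is_generator[OF p_gt_1(1) g] prime
    by (simp add: totient_prime totatives_prime)
  hence *: "(\<Sum>j<p - 1. f (int (g ^ j mod p))) = (\<Sum>x\<in>{0<..<p}. f (int x))"
    by (rule sum.reindex_bij_betw)
  have "{0..<int p} = int ` {0..<p}"
    by (simp add: image_int_atLeastLessThan)
  hence "(\<Sum>x\<in>{0..<int p}. f x) = (\<Sum>x\<in>{0..<p}. f (int x))"
    by (simp add: sum.reindex)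
  also have "{0..<p} = insert 0 {0<..<p}" using p_pos by auto
  also have "(\<Sum>x\<in>insert 0 {0<..<p}. f (int x)) = f 0 + (\<Sum>x\<in>{0<..<p}. f (int x))"
    by simp
  also note *[symmetric]
  also have "(\<Sum>j<p - 1. f (int (g ^ j mod p))) = (\<Sum>j<p - 1. f (int g ^ j))"
    by (intro sum.cong f) (simp_all add: cong_def zmod_int)
  finally show ?thesis .
qed

lemma primroot_power_cong_1_iff:
  assumes "residue_primroot p g"
  shows "[int g ^ k = 1] (mod int p) \<longleftrightarrow> (p - 1) dvd k"
proof -
  have "ord p g = p - 1"
    using assms prime by (simp add: residue_primroot_def totient_prime)
  hence "[g ^ k = 1] (mod p) \<longleftrightarrow> (p - 1) dvd k"
    by (metis ord_divides)
  thus ?thesis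
    by (metis cong_int_iff of_nat_1 of_nat_power)
qed

lemma chi_primroot:
  assumes "residue_primroot p g"
  shows "\<chi> (int g) = -1"
proof -
  have "\<not> p dvd g"
    using assms prime by (auto simp: residue_primroot_def dest: coprime_absorb_left)
  hence "\<chi> (int g) \<noteq> 0" by (simp add: chi_eq_0_iff)
  moreover have "\<chi> (int g) \<noteq> 1"
  proof
    assume "\<chi> (int g) = 1"
    hence "[int g ^ ((p - 1) div 2) = 1] (mod int p)"
      using euler[of "int g"] by (simp add: cong_sym)
    hence "(p - 1) dvd (p - 1) div 2"
      by (simp add: primroot_power_cong_1_iff[OF assms])
    thus False using gt_2 by (auto dest: dvd_imp_le)
  qed
  ultimately show ?thesis using chi_cases by blast
qed

text \<open>Multiplication by a primitive root permutes the residues and negates every term.\<close>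

lemma sum_chi: "(\<Sum>x\<in>{0..<int p}. \<chi> x) = 0"
proof -
  obtain g where g: "residue_primroot p g" using ex_primroot by blast
  have "coprime (int g) (int p)"
    using chi_primroot[OF g] chi_eq_0_iff[of "int g"] by (simp add: coprime_iff)
  hence "(\<Sum>x\<in>{0..<int p}. \<chi> (int g * x)) = (\<Sum>x\<in>{0..<int p}. \<chi> x)"
    by (intro sum_residues_mult chi_cong) auto
  thus ?thesis
    by (simp add: chi_mult chi_primroot[OF g] sum_negf)
qed

lemma sum_chi_square: "(\<Sum>x\<in>{0..<int p}. \<chi> x * \<chi> x) = int p - 1"
proof -
  have eq: "{0..<int p} = insert 0 {1..<int p}" using p_pos by auto
  have "(\<Sum>x\<in>{1..<int p}. \<chi> x * \<chi> x) = (\<Sum>x\<in>{1..<int p}. 1)"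
    by (intro sum.cong chi_square) (auto dest: zdvd_imp_le)
  thus ?thesis
    using p_pos unfolding eq by (simp add: chi_eq_0_iff[THEN iffD2])
qed

lemma sum_chi_shift: "(\<Sum>x\<in>{0..<int p}. \<chi> (x + c)) = 0"
  using sum_residues_shift[of "int p" \<chi> c] chi_cong sum_chi by simp

text \<open>The sum does not depend on \<open>d\<close> by the substitution \<open>k \<mapsto> d * k\<close>, and it averages out
  with the value \<open>p - 1\<close> at \<open>d = 0\<close>.\<close>

lemma sum_chi_quadratic:
  assumes "\<not> int p dvd d"
  shows "(\<Sum>k\<in>{0..<int p}. \<chi> k * \<chi> (k + d)) = -1"
proof -
  define F where "F d = (\<Sum>k\<in>{0..<int p}. \<chi> k * \<chi> (k + d))" for d
  have F: "F d = F 1" if "\<not> int p dvd d" for d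
  proof -
    have "F d = (\<Sum>k\<in>{0..<int p}. \<chi> (d * k) * \<chi> (d * k + d))"
      unfolding F_def
      by (intro sum_residues_mult[symmetric] arg_cong2[where f="(*)"] chi_cong)
         (use that in \<open>auto simp: coprime_iff cong_add_rcancel\<close>)
    also have "\<dots> = (\<Sum>k\<in>{0..<int p}. (\<chi> d * \<chi> d) * (\<chi> k * \<chi> (k + 1)))"
    proof (rule sum.cong[OF refl])
      fix k
      have "d * k + d = d * (k + 1)" by (simp add: algebra_simps)
      thus "\<chi> (d * k) * \<chi> (d * k + d) = (\<chi> d * \<chi> d) * (\<chi> k * \<chi> (k + 1))"
        by (simp only: chi_mult mult_ac)
    qed
    also have "\<dots> = F 1" by (simp add: chi_square[OF that] F_def)
    finally show ?thesis .
  qed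
  have "(\<Sum>d\<in>{0..<int p}. F d) = (\<Sum>k\<in>{0..<int p}. \<Sum>d\<in>{0..<int p}. \<chi> k * \<chi> (d + k))"
    unfolding F_def by (subst sum.swap) (simp add: add.commute)
  also have "\<dots> = 0"
    by (simp add: sum_distrib_left[symmetric] sum_chi_shift)
  finally have "(\<Sum>d\<in>{0..<int p}. F d) = 0" .
  moreover have "{0..<int p} = insert 0 {1..<int p}" using p_pos by auto
  moreover have "(\<Sum>d\<in>{1..<int p}. F d) = (\<Sum>d\<in>{1..<int p}. F 1)"
    by (intro sum.cong F) (auto dest: zdvd_imp_le)
  moreover have "F 0 = int p - 1" by (simp add: F_def sum_chi_square)
  ultimately have "(int p - 1) * (F 1 + 1) = 0" 
    using p_gt_1 by (simp add: algebra_simps of_nat_diff)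
  hence "F 1 = -1" using p_gt_1 by auto
  with F[OF assms] show ?thesis by (simp add: F_def)
qed

text \<open>Substituting \<open>u - k\<close> for \<open>k\<close> gives the preceding quadratic sum
  with \<open>d = v - u\<close>. This is the orthogonality relation behind the second moment
  below.\<close>

lemma sum_chi_diff_prod:
  "(\<Sum>k\<in>{0..<int p}. \<chi> (u - k) * \<chi> (v - k)) = (if [u = v] (mod int p) then int p - 1 else -1)"
proof -
  have "(\<Sum>k\<in>{0..<int p}. \<chi> (u - k) * \<chi> (v - k)) =
        (\<Sum>k\<in>{0..<int p}. \<chi> (u - (u - k)) * \<chi> (v - (u - k)))"
  proof (rule sum_residues_reindex[symmetric])
    fix x y
    show "[x = y] (mod int p) \<Longrightarrow> \<chi> (u - x) * \<chi> (v - x) = \<chi> (u - y) * \<chi> (v - y)"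
      by (intro arg_cong2[where f="(*)"] chi_cong cong_diff cong_refl)
    show "[u - x = u - y] (mod int p) \<Longrightarrow> [x = y] (mod int p)"
      using cong_diff[OF cong_refl[of u]] by fastforce
  qed simp
  also have "\<dots> = (\<Sum>k\<in>{0..<int p}. \<chi> k * \<chi> (k + (v - u)))"
    by (simp add: algebra_simps)
  also have "\<dots> = (if [u = v] (mod int p) then int p - 1 else -1)"
  proof (cases "[u = v] (mod int p)")
    case True
    hence "\<chi> (k + (v - u)) = \<chi> k" for k
      by (intro chi_cong) (simp add: cong_iff_dvd_diff dvd_diff_commute)
    with True show ?thesis by (simp add: sum_chi_square)
  next
    case False
    hence "\<not> int p dvd (v - u)" by (simp add: cong_iff_dvd_diff dvd_diff_commute)
    from sum_chi_quadratic[OF this] False show ?thesis by simp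
  qed
  finally show ?thesis .
qed

text \<open>For \<open>k\<close> prime to \<open>p\<close> this is minus the trace of Frobenius of
  the curve y^2 = x^3 - k x. The case \<open>k = 1\<close> is the one of interest; the other
  \<open>k\<close> are the twists over which its square is averaged.\<close>

definition jacobsthal :: "int \<Rightarrow> int"
  where "jacobsthal k = (\<Sum>x\<in>{0..<int p}. \<chi> x * \<chi> (x\<^sup>2 - k))"

lemma jacobsthal_cong: "[k = l] (mod int p) \<Longrightarrow> jacobsthal k = jacobsthal l"
  unfolding jacobsthal_def
  by (intro sum.cong refl arg_cong2[where f="(*)"] chi_cong[OF cong_diff] cong_refl)

text \<open>Substitute \<open>t * x\<close> for \<open>x\<close>. Up to sign the sum depends only on
  the class of \<open>k\<close> modulo squares.\<close>

lemma jacobsthal_scale: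
  assumes "\<not> int p dvd t"
  shows "jacobsthal (t\<^sup>2 * k) = \<chi> t * jacobsthal k"
proof -
  have "jacobsthal (t\<^sup>2 * k) = (\<Sum>x\<in>{0..<int p}. \<chi> (t * x) * \<chi> ((t * x)\<^sup>2 - t\<^sup>2 * k))"
    unfolding jacobsthal_def
  proof (rule sum_residues_mult[where f = "\<lambda>x. \<chi> x * \<chi> (x\<^sup>2 - t\<^sup>2 * k)", symmetric])
    fix x y
    show "[x = y] (mod int p) \<Longrightarrow> \<chi> x * \<chi> (x\<^sup>2 - t\<^sup>2 * k) = \<chi> y * \<chi> (y\<^sup>2 - t\<^sup>2 * k)"
      by (intro arg_cong2[where f="(*)"] chi_cong cong_diff cong_pow cong_refl)
  qed (use assms in \<open>simp_all add: coprime_iff\<close>)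
  also have "\<dots> = (\<Sum>x\<in>{0..<int p}. \<chi> t * (\<chi> x * \<chi> (x\<^sup>2 - k)))"
  proof (rule sum.cong[OF refl])
    fix x
    have "(t * x)\<^sup>2 - t\<^sup>2 * k = (t * t) * (x\<^sup>2 - k)" by (simp add: algebra_simps power2_eq_square)
    thus "\<chi> (t * x) * \<chi> ((t * x)\<^sup>2 - t\<^sup>2 * k) = \<chi> t * (\<chi> x * \<chi> (x\<^sup>2 - k))"
      by (simp only: chi_mult) (use chi_square[OF assms] in simp)
  qed
  also have "\<dots> = \<chi> t * jacobsthal k"
    by (simp add: jacobsthal_def sum_distrib_left)
  finally show ?thesis .
qed

text \<open>Expand the square and sum over \<open>k\<close> first. Orthogonality leaves p times the
  pairs with x^2 = y^2, minus (sum of all character values)^2 = 0. The pairs are y = x and y = -x,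
  which contribute equally because -1 is a square.\<close>

lemma sum_jacobsthal_square:
  assumes "\<chi> (-1) = 1"
  shows "(\<Sum>k\<in>{0..<int p}. (jacobsthal k)\<^sup>2) = 2 * int p * (int p - 1)"
proof -
  let ?R = "{0..<int p}"
  have sq: "[x\<^sup>2 = y\<^sup>2] (mod int p) \<longleftrightarrow> y = x \<or> y = (- x) mod int p"
    if "x \<in> ?R" "y \<in> ?R" for x y
  proof -
    have "[x\<^sup>2 = y\<^sup>2] (mod int p) \<longleftrightarrow> int p dvd (x - y) * (x + y)"
      by (simp add: cong_iff_dvd_diff algebra_simps power2_eq_square)
    also have "\<dots> \<longleftrightarrow> [y = x] (mod int p) \<or> [y = - x] (mod int p)"
      by (simp add: prime_dvd_mult_iff[OF prime_int] cong_iff_dvd_diff dvd_diff_commute add.commute)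
    also have "\<dots> \<longleftrightarrow> y = x \<or> y = (- x) mod int p"
      using that by (simp add: cong_def)
    finally show ?thesis .
  qed
  have diag: "(\<Sum>y\<in>?R. if [x\<^sup>2 = y\<^sup>2] (mod int p) then \<chi> x * \<chi> y else 0) = 2 * (\<chi> x * \<chi> x)"
    if x: "x \<in> ?R" for x
  proof (cases "x = 0")
    case True
    hence "\<chi> x = 0" by (simp add: chi_eq_0_iff)
    thus ?thesis by (auto intro!: sum.neutral)
  next
    case False
    have ne: "(- x) mod int p \<noteq> x"
    proof
      assume "(- x) mod int p = x"
      hence "[- x = x] (mod int p)" using x by (simp add: cong_def)
      hence "int p dvd 2 * x" by (simp add: cong_iff_dvd_diff)
      hence "int p dvd 2 \<or> int p dvd x" by (simp add: prime_dvd_mult_iff[OF prime_int])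
      thus False using x False gt_2 by (auto dest: zdvd_imp_le)
    qed
    have "(\<Sum>y\<in>?R. if [x\<^sup>2 = y\<^sup>2] (mod int p) then \<chi> x * \<chi> y else 0) =
          (\<Sum>y\<in>?R. if y \<in> {x, (- x) mod int p} then \<chi> x * \<chi> y else 0)"
      by (intro sum.cong) (use sq x in auto)
    also have "\<dots> = (\<Sum>y\<in>{x, (- x) mod int p}. \<chi> x * \<chi> y)"
      by (rule sum.mono_neutral_cong_right) (use x in auto)
    also have "\<dots> = \<chi> x * \<chi> x + \<chi> x * \<chi> ((- x) mod int p)"
      using ne by simp
    also have "\<chi> ((- x) mod int p) = \<chi> ((-1) * x)"
      by (rule chi_cong) (simp add: cong_def)
    also have "\<dots> = \<chi> x" using assms by (simp only: chi_mult)
    finally show ?thesis by simp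
  qed
  have "(\<Sum>k\<in>?R. (jacobsthal k)\<^sup>2) =
      (\<Sum>k\<in>?R. \<Sum>x\<in>?R. \<Sum>y\<in>?R. \<chi> x * \<chi> y * (\<chi> (x\<^sup>2 - k) * \<chi> (y\<^sup>2 - k)))"
    by (simp add: jacobsthal_def power2_eq_square sum_product mult_ac)
  also have "\<dots> = (\<Sum>x\<in>?R. \<Sum>y\<in>?R. \<chi> x * \<chi> y * (\<Sum>k\<in>?R. \<chi> (x\<^sup>2 - k) * \<chi> (y\<^sup>2 - k)))"
    by (subst sum.swap, rule sum.cong[OF refl], subst sum.swap) (simp add: sum_distrib_left)
  also have "\<dots> = (\<Sum>x\<in>?R. \<Sum>y\<in>?R.
      int p * (if [x\<^sup>2 = y\<^sup>2] (mod int p) then \<chi> x * \<chi> y else 0) - \<chi> x * \<chi> y)"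
    by (intro sum.cong refl) (auto simp: sum_chi_diff_prod algebra_simps)
  also have "\<dots> = int p * (\<Sum>x\<in>?R. \<Sum>y\<in>?R. if [x\<^sup>2 = y\<^sup>2] (mod int p) then \<chi> x * \<chi> y else 0)
      - (\<Sum>x\<in>?R. \<chi> x) * (\<Sum>y\<in>?R. \<chi> y)"
    by (simp only: sum_subtractf sum_distrib_left[symmetric] sum_distrib_right[symmetric])
  also have "(\<Sum>x\<in>?R. \<Sum>y\<in>?R. if [x\<^sup>2 = y\<^sup>2] (mod int p) then \<chi> x * \<chi> y else 0)
      = (\<Sum>x\<in>?R. 2 * (\<chi> x * \<chi> x))"
    by (intro sum.cong diag refl)
  also have "\<dots> = 2 * (int p - 1)"
    by (simp add: sum_distrib_left[symmetric] sum_chi_square)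
  finally show ?thesis by (simp add: sum_chi)
qed

text \<open>The squared sum is 0 at \<open>k = 0\<close>, constant on nonzero squares and constant
  on non-squares, and each of the two classes has (p - 1)/2 elements; the second moment therefore
  determines the sum of the two constants.\<close>

lemma jacobsthal_square_sum:
  assumes "\<chi> (-1) = 1" and g: "\<chi> g = -1"
  shows "(jacobsthal 1)\<^sup>2 + (jacobsthal g)\<^sup>2 = 4 * int p"
proof -
  let ?R = "{0..<int p}" and ?S = "(jacobsthal 1)\<^sup>2" and ?T = "(jacobsthal g)\<^sup>2"
  have gp: "\<not> int p dvd g" using g chi_eq_0_iff[of g] by auto
  have scale: "(jacobsthal (t\<^sup>2 * k))\<^sup>2 = (jacobsthal k)\<^sup>2" if "\<not> int p dvd t" for t k
  proof -
    have "(\<chi> t)\<^sup>2 = 1" using chi_square[OF that] by (simp only: power2_eq_square)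
    thus ?thesis by (simp only: jacobsthal_scale[OF that] power_mult_distrib mult_1_left)
  qed
  \<comment> \<open>The three cases are interpolated by a polynomial in \<open>\<chi> k\<close>, so
    that summation over \<open>k\<close> needs only \<open>sum_chi\<close> and
    \<open>sum_chi_square\<close>.\<close>
  have val: "2 * (jacobsthal k)\<^sup>2 = (\<chi> k * \<chi> k) * (?S + ?T) + \<chi> k * (?S - ?T)" for k
  proof -
    consider "\<chi> k = 0" | "\<chi> k = 1" | "\<chi> k = -1" using chi_cases by blast
    thus ?thesis
    proof cases
      case 1
      hence "[k = 0] (mod int p)" by (simp add: chi_eq_0_iff cong_0_iff)
      hence "jacobsthal k = jacobsthal 0" by (rule jacobsthal_cong)
      also have "\<dots> = (\<Sum>x\<in>?R. \<chi> x)"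
        unfolding jacobsthal_def
      proof (rule sum.cong[OF refl])
        fix x
        show "\<chi> x * \<chi> (x\<^sup>2 - 0) = \<chi> x"
          using chi_cases[of x] by (auto simp: chi_power)
      qed
      finally show ?thesis using 1 by (simp add: sum_chi)
    next
      case 2
      then obtain t where t: "[t\<^sup>2 = k] (mod int p)" using chi_eq_1_imp_square by blast
      hence "\<not> int p dvd t" using 2 chi_cong[OF t] chi_eq_0_iff[of "t\<^sup>2"]
        by (auto simp: power2_eq_square)
      moreover have "jacobsthal k = jacobsthal (t\<^sup>2 * 1)"
        by (rule jacobsthal_cong) (simp add: t cong_sym)
      ultimately show ?thesis using 2 scale[of t 1] by simp
    next
      case 3
      hence "\<chi> (k * g) = 1" using g by (simp add: chi_mult)
      then obtain t where t: "[t\<^sup>2 = k * g] (mod int p)" using chi_eq_1_imp_square by blast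
      hence tp: "\<not> int p dvd t" using \<open>\<chi> (k * g) = 1\<close> chi_cong[OF t] chi_eq_0_iff[of "t\<^sup>2"]
        by (auto simp: power2_eq_square)
      \<comment> \<open>A non-square \<open>k\<close> is moved to the class of \<open>g\<close>: as
        \<open>k * g\<close> is a square t^2, g^2 k is congruent to t^2 g.\<close>
      have "(jacobsthal k)\<^sup>2 = (jacobsthal (g\<^sup>2 * k))\<^sup>2" using scale[OF gp] by simp
      also have "jacobsthal (g\<^sup>2 * k) = jacobsthal (t\<^sup>2 * g)"
        by (rule jacobsthal_cong) (use cong_scalar_right[OF t, of g] in
              \<open>simp add: power2_eq_square mult_ac cong_sym\<close>)
      also have "(jacobsthal (t\<^sup>2 * g))\<^sup>2 = ?T" using scale[OF tp] by simp
      finally show ?thesis using 3 by simp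
    qed
  qed
  have "2 * (2 * int p * (int p - 1)) = (\<Sum>k\<in>?R. 2 * (jacobsthal k)\<^sup>2)"
    by (simp add: sum_distrib_left[symmetric] sum_jacobsthal_square[OF assms(1)])
  also have "\<dots> = (\<Sum>k\<in>?R. (\<chi> k * \<chi> k) * (?S + ?T)) + (\<Sum>k\<in>?R. \<chi> k * (?S - ?T))"
    unfolding sum.distrib[symmetric] by (rule sum.cong[OF refl val])
  also have "\<dots> = (int p - 1) * (?S + ?T)"
    by (simp only: sum_distrib_right[symmetric] sum_chi_square sum_chi mult_zero_left add_0_right)
  finally have "(int p - 1) * (4 * int p) = (int p - 1) * (?S + ?T)"
    by (simp add: algebra_simps)
  thus ?thesis using p_gt_1 by simp
qed

end

subsection \<open>The Jacobsthal sum and the two-squares representation\<close>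

text \<open>p divides (ad - bc)(ad + bc) = p (a^2 - c^2), hence one factor. In p^2 = (ac + bd)^2 +
  (ad - bc)^2 the first square is positive, so a multiple ad - bc of p must vanish.\<close>

lemma prime_two_squares_unique:
  fixes p a b c d :: int
  assumes p: "prime p" "odd p"
    and ab: "p = a\<^sup>2 + b\<^sup>2" and cd: "p = c\<^sup>2 + d\<^sup>2" and odd: "odd a" "odd c"
  shows "a\<^sup>2 = c\<^sup>2"
proof -
  \<comment> \<open>Stated for a fresh \<open>d\<close>, so that the case where p divides ad + bc
    follows by negating \<open>d\<close>.\<close>
  have main: "a\<^sup>2 = c\<^sup>2" if d: "p = c\<^sup>2 + d\<^sup>2" and dvd: "p dvd a * d - b * c" for d
  proof -
    obtain k where k: "a * d - b * c = p * k" using dvd by (elim dvdE)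
    have p0: "p > 0" using p(1) by (simp add: prime_gt_0_int)
    have sum: "(a * c + b * d)\<^sup>2 + (a * d - b * c)\<^sup>2 = p * p"
    proof -
      have "(a * c + b * d)\<^sup>2 + (a * d - b * c)\<^sup>2 = (a\<^sup>2 + b\<^sup>2) * (c\<^sup>2 + d\<^sup>2)"
        by (simp add: power2_eq_square algebra_simps)
      thus ?thesis using ab d by simp
    qed
    \<comment> \<open>By parity: \<open>a\<close> and \<open>c\<close> are odd and \<open>b\<close>
      is even, so this number is odd.\<close>
    have "a * c + b * d \<noteq> 0"
    proof
      assume "a * c + b * d = 0"
      moreover have "even b" using ab odd(1) p(2) by auto
      ultimately show False using odd by (metis even_add even_mult_iff even_zero)
    qed
    hence "0 < (a * c + b * d)\<^sup>2" by simp
    with sum have "(p * k)\<^sup>2 < p * p" unfolding k by linarith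
    hence "(p * p) * k\<^sup>2 < (p * p) * 1" by (simp add: power2_eq_square mult_ac)
    hence "k\<^sup>2 < 1" using p0 by (simp only: mult_less_cancel_left_pos mult_pos_pos)
    hence "k = 0" by (metis zero_less_power2 not_less zero_less_iff_neq_zero int_one_le_iff_zero_less)
    hence "(a * d)\<^sup>2 = (b * c)\<^sup>2" using k by simp
    moreover have "d\<^sup>2 = p - c\<^sup>2" "b\<^sup>2 = p - a\<^sup>2" using ab d by simp_all
    ultimately have "a\<^sup>2 * (p - c\<^sup>2) = (p - a\<^sup>2) * c\<^sup>2"
      by (simp only: power_mult_distrib)
    hence "p * a\<^sup>2 = p * c\<^sup>2" by (simp add: algebra_simps)
    thus ?thesis using p0 by simp
  qed
  have "(a * d - b * c) * (a * d + b * c) = a\<^sup>2 * d\<^sup>2 - b\<^sup>2 * c\<^sup>2"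
    by (simp add: power2_eq_square algebra_simps)
  moreover have "d\<^sup>2 = p - c\<^sup>2" "b\<^sup>2 = p - a\<^sup>2" using ab cd by simp_all
  ultimately have "(a * d - b * c) * (a * d + b * c) = a\<^sup>2 * (p - c\<^sup>2) - (p - a\<^sup>2) * c\<^sup>2"
    by (simp only:)
  also have "\<dots> = p * (a\<^sup>2 - c\<^sup>2)" by (simp add: algebra_simps)
  finally have "p dvd (a * d - b * c) * (a * d + b * c)" by simp
  hence "p dvd a * d - b * c \<or> p dvd a * d + b * c"
    by (simp add: prime_dvd_mult_iff[OF p(1)])
  thus ?thesis
  proof
    assume "p dvd a * d + b * c"
    hence "p dvd a * (- d) - b * c" by (metis dvd_minus_iff minus_diff_eq mult_minus_right diff_minus_eq_add add.commute)
    thus ?thesis using main[of "- d"] cd by simp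
  qed (use main[OF cd] in simp)
qed

locale prime_1_mod_4 =
  fixes p m :: nat
  assumes prime: "prime p" and p_eq: "p = 4 * m + 1"

sublocale prime_1_mod_4 \<subseteq> odd_prime p
proof
  show "2 < p" using prime p_eq by (cases m) auto
qed (rule prime)

context prime_1_mod_4
begin

lemma m_pos: "m > 0"
  using gt_2 p_eq by simp

lemma chi_minus_1: "\<chi> (-1) = 1"
proof (rule eq_if_cong_small[OF _ chi_abs_le])
  have "(p - 1) div 2 = 2 * m" using p_eq by simp
  thus "[\<chi> (-1) = 1] (mod int p)" using euler[of "-1"] by simp
qed simp

lemma primroot_power_half:
  assumes "residue_primroot p g"
  shows "[int g ^ (2 * m) = -1] (mod int p)"
proof -
  have "(p - 1) div 2 = 2 * m" using p_eq by simp
  thus ?thesis using euler[of "int g"] chi_primroot[OF assms] by (simp add: cong_sym)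
qed

text \<open>With \<open>i\<^sup>2 = -1\<close> one has \<open>2 * i = (1 + i)\<^sup>2\<close>, so \<open>2 * i\<close> has trivial \<open>2 * m\<close>-th power.\<close>

lemma four_power_cong: "[4 ^ m = (-1) ^ m] (mod int p)"
proof -
  obtain g where g: "residue_primroot p g" using ex_primroot by blast
  define i where "i = int g ^ m"
  have i2: "[i\<^sup>2 = -1] (mod int p)"
    using primroot_power_half[OF g] by (simp add: i_def power_mult[symmetric] mult.commute)
  have sq: "[(1 + i)\<^sup>2 = 2 * i] (mod int p)"
  proof -
    have "(1 + i)\<^sup>2 = 2 * i + (1 + i\<^sup>2)" by (simp add: power2_eq_square algebra_simps)
    also have "[2 * i + (1 + i\<^sup>2) = 2 * i + (1 + -1)] (mod int p)"
      by (intro cong_add cong_refl i2)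
    finally show ?thesis by simp
  qed
  have "\<not> int p dvd 1 + i"
  proof
    assume "int p dvd 1 + i"
    hence "int p dvd (1 + i) * (1 - i) + (i\<^sup>2 - -1)"
      using i2 by (intro dvd_add[OF dvd_mult2]) (simp_all only: cong_iff_dvd_diff)
    also have "(1 + i) * (1 - i) + (i\<^sup>2 - -1) = 2"
      by (simp add: power2_eq_square algebra_simps)
    finally show False using gt_2 by (auto dest: zdvd_imp_le)
  qed
  have "\<chi> ((1 + i)\<^sup>2) = 1"
    using chi_square[OF \<open>\<not> int p dvd 1 + i\<close>] by (simp only: power2_eq_square chi_mult)
  hence "\<chi> (2 * i) = 1" using chi_cong[OF sq] by simp
  moreover have "(p - 1) div 2 = 2 * m" using p_eq by simp
  ultimately have 1: "[(2 * i) ^ (2 * m) = 1] (mod int p)"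
    using euler[of "2 * i"] by (simp add: cong_sym)
  have "[4 ^ m * (-1) ^ m = 4 ^ m * (i\<^sup>2) ^ m] (mod int p)"
    by (intro cong_mult cong_refl cong_pow i2[THEN cong_sym])
  also have "4 ^ m * (i\<^sup>2) ^ m = (2 * i) ^ (2 * m)"
    by (simp add: power_mult power_mult_distrib)
  also note 1
  finally have "[4 ^ m * (-1) ^ m * (-1) ^ m = 1 * (-1) ^ m] (mod int p)"
    by (rule cong_scalar_right)
  moreover have "4 ^ m * (-1) ^ m * (-1) ^ m = (4 :: int) ^ m"
    by (simp add: power_mult_distrib[symmetric] mult.assoc)
  ultimately show ?thesis by simp
qed

lemma chi_2: "\<chi> 2 = (-1) ^ m"
proof (rule eq_if_cong_small[OF _ chi_abs_le])
  have "(p - 1) div 2 = 2 * m" using p_eq by simp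
  hence "[\<chi> 2 = 4 ^ m] (mod int p)" using euler[of 2] by (simp add: power_mult)
  thus "[\<chi> 2 = (-1) ^ m] (mod int p)" using four_power_cong by (rule cong_trans)
qed (cases "even m"; simp)

lemma jacobsthal_1_primroot:
  assumes "residue_primroot p g"
  shows "jacobsthal 1 = (\<Sum>j<4 * m. \<chi> (int g ^ j) * \<chi> ((int g ^ j)\<^sup>2 - 1))"
proof -
  have "jacobsthal 1 = \<chi> 0 * \<chi> (0\<^sup>2 - 1) + (\<Sum>j<p - 1. \<chi> (int g ^ j) * \<chi> ((int g ^ j)\<^sup>2 - 1))"
    unfolding jacobsthal_def
  proof (rule sum_residues_primroot[OF assms])
    fix x y
    show "[x = y] (mod int p) \<Longrightarrow> \<chi> x * \<chi> (x\<^sup>2 - 1) = \<chi> y * \<chi> (y\<^sup>2 - 1)"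
      by (intro arg_cong2[where f="(*)"] chi_cong cong_diff cong_pow cong_refl)
  qed
  moreover have "\<chi> 0 = 0" by (simp add: chi_eq_0_iff)
  ultimately show ?thesis using p_eq by simp
qed

text \<open>The summand is invariant under \<open>x \<mapsto> -x\<close> and \<open>x \<mapsto> 1/x\<close>, that is under
  \<open>j \<mapsto> j + 2 * m\<close> and \<open>j \<mapsto> -j\<close> on exponents; the exceptional orbits
  are those of \<open>1\<close> and of a square root of \<open>-1\<close>.\<close>

lemma jacobsthal_1_mod_8: "[jacobsthal 1 = 4 * int m - 2] (mod 8)"
proof -
  obtain g where g: "residue_primroot p g" using ex_primroot by blast
  define G where "G = int g"
  define F where "F j = \<chi> (G ^ j) * \<chi> ((G ^ j)\<^sup>2 - 1)" for j
  have chi_G: "\<chi> (G ^ j) = (-1) ^ j" for j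
    using chi_primroot[OF g] by (simp add: chi_power G_def)
  have half: "[G ^ (2 * m) = -1] (mod int p)"
    using primroot_power_half[OF g] by (simp add: G_def)
  have full: "[G ^ (4 * m) = 1] (mod int p)"
    using primroot_power_cong_1_iff[OF g, of "4 * m"] p_eq by (simp add: G_def)
  have shift: "F (j + 2 * m) = F j" for j
  proof -
    have "(j + 2 * m) * 2 = j * 2 + 4 * m" by simp
    hence "(G ^ (j + 2 * m))\<^sup>2 - 1 = (G ^ j)\<^sup>2 * G ^ (4 * m) - 1"
      by (simp only: flip: power_mult power_add)
    also have "[\<dots> = (G ^ j)\<^sup>2 * 1 - 1] (mod int p)"
      by (intro cong_diff cong_mult cong_refl full)
    finally have "\<chi> ((G ^ (j + 2 * m))\<^sup>2 - 1) = \<chi> ((G ^ j)\<^sup>2 - 1)"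
      using chi_cong by simp
    moreover have "(-1 :: int) ^ (j + 2 * m) = (-1) ^ j" by (simp add: power_add)
    ultimately show ?thesis by (simp only: F_def chi_G)
  qed
  have refl: "F (2 * m - j) = F j" if "j \<le> 2 * m" for j
  proof -
    have eq: "(G ^ j)\<^sup>2 * (G ^ (2 * m - j))\<^sup>2 = G ^ (4 * m)"
    proof -
      have "j * 2 + (2 * m - j) * 2 = 4 * m" using that by simp
      thus ?thesis by (simp only: flip: power_mult power_add)
    qed
    have "(G ^ j)\<^sup>2 * ((G ^ (2 * m - j))\<^sup>2 - 1) = G ^ (4 * m) - (G ^ j)\<^sup>2"
      using eq by (simp add: algebra_simps)
    also have "[\<dots> = 1 - (G ^ j)\<^sup>2] (mod int p)"
      by (intro cong_diff cong_refl full)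
    also have "1 - (G ^ j)\<^sup>2 = (-1) * ((G ^ j)\<^sup>2 - 1)" by simp
    finally have "\<chi> ((G ^ j)\<^sup>2 * ((G ^ (2 * m - j))\<^sup>2 - 1)) = \<chi> ((-1) * ((G ^ j)\<^sup>2 - 1))"
      by (rule chi_cong)
    hence "\<chi> ((G ^ (2 * m - j))\<^sup>2 - 1) = \<chi> ((G ^ j)\<^sup>2 - 1)"
      by (simp only: chi_mult chi_minus_1 chi_power[of _ 2] chi_G) (simp add: power_mult[symmetric])
    moreover have "(-1 :: int) ^ (2 * m - j) = (-1) ^ j"
      using that by (cases "even j") (simp_all add: uminus_power_if)
    ultimately show ?thesis by (simp add: F_def chi_G)
  qed
  have F0: "F 0 = 0" by (simp add: F_def chi_eq_0_iff)
  have Fm: "F m = 1"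
  proof -
    have "(G ^ m)\<^sup>2 - 1 = G ^ (2 * m) - 1" by (simp add: power_mult[symmetric] mult.commute)
    also have "[\<dots> = -1 - 1] (mod int p)" by (intro cong_diff cong_refl half)
    also have "-1 - 1 = (-1) * (2 :: int)" by simp
    finally have "\<chi> ((G ^ m)\<^sup>2 - 1) = \<chi> ((-1) * 2)" by (rule chi_cong)
    hence "\<chi> ((G ^ m)\<^sup>2 - 1) = (-1) ^ m" by (simp only: chi_mult chi_minus_1 chi_2 mult_1_left)
    thus ?thesis by (simp add: F_def chi_G flip: power_add mult_2)
  qed
  have odd_F: "odd (F j)" if j: "0 < j" "j < m" for j
  proof -
    have "\<not> int p dvd (G ^ j)\<^sup>2 - 1"
    proof
      assume "int p dvd (G ^ j)\<^sup>2 - 1"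
      hence "[int g ^ (2 * j) = 1] (mod int p)"
        by (simp add: cong_iff_dvd_diff G_def power_mult[symmetric] mult.commute)
      hence "4 * m dvd 2 * j" using primroot_power_cong_1_iff[OF g] p_eq by simp
      thus False using j by (auto dest: dvd_imp_le)
    qed
    thus ?thesis using chi_cases[of "(G ^ j)\<^sup>2 - 1"]
      by (auto simp: F_def chi_G chi_eq_0_iff)
  qed
  define Q where "Q = (\<Sum>j\<in>{1..<m}. F j)"
  have upper: "(\<Sum>j\<in>{m<..<2 * m}. F j) = Q"
    unfolding Q_def
    by (rule sum.reindex_bij_witness[of _ "\<lambda>j. 2 * m - j" "\<lambda>j. 2 * m - j"])
       (use refl in auto)
  have "(\<Sum>j<2 * m. F j) = 1 + 2 * Q"
  proof -
    have "{..<2 * m} = insert 0 (insert m ({1..<m} \<union> {m<..<2 * m}))"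
      using m_pos by auto
    moreover have "(\<Sum>j\<in>{1..<m} \<union> {m<..<2 * m}. F j) = Q + Q"
      using upper by (subst sum.union_disjoint) (auto simp: Q_def)
    ultimately show ?thesis using m_pos F0 Fm by simp
  qed
  moreover have "(\<Sum>j<4 * m. F j) = (\<Sum>j<2 * m. F j) + (\<Sum>j<2 * m. F (j + 2 * m))"
  proof -
    have "(\<Sum>j<2 * m + k. F j) = (\<Sum>j<2 * m. F j) + (\<Sum>j<k. F (j + 2 * m))" for k
      by (induction k) (simp_all add: add.commute)
    from this[of "2 * m"] show ?thesis by simp
  qed
  moreover have "jacobsthal 1 = (\<Sum>j<4 * m. F j)"
    using jacobsthal_1_primroot[OF g] by (simp add: F_def G_def)
  ultimately have S: "jacobsthal 1 = 2 + 4 * Q" by (simp add: shift)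
  \<comment> \<open>In S = 2 + 4 Q only the parity of Q matters modulo 8. All m - 1 terms of Q are 1
    or -1, so Q has the parity of m - 1.\<close>
  have "even (\<Sum>j\<in>{1..<m}. F j - 1)"
    by (rule dvd_sum) (use odd_F in auto)
  hence "even (Q - int (m - 1))"
    by (simp add: sum_subtractf Q_def)
  then obtain k where "Q - int (m - 1) = 2 * k" by (elim evenE)
  hence "jacobsthal 1 - (4 * int m - 2) = 8 * k"
    using S m_pos by (simp add: of_nat_diff algebra_simps)
  thus ?thesis by (simp add: cong_iff_dvd_diff)
qed

text \<open>The halves A and B of the two Jacobsthal sums satisfy p = A^2 + B^2 with A odd, so A is
  a or -a. Since A is 2m - 1 modulo 4 and a is 1 modulo 4, the parity of m decides between
  them.\<close>

theorem jacobsthal_1: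
  fixes a b :: int
  assumes ab: "int p = a\<^sup>2 + b\<^sup>2" and a: "4 dvd a - 1"
  shows "jacobsthal 1 = - ((-1) ^ m) * (2 * a)"
proof -
  obtain g where g: "residue_primroot p g" using ex_primroot by blast
  have sum: "(jacobsthal 1)\<^sup>2 + (jacobsthal (int g))\<^sup>2 = 4 * int p"
    by (rule jacobsthal_square_sum[OF chi_minus_1 chi_primroot[OF g]])
  obtain k where k: "jacobsthal 1 - (4 * int m - 2) = 8 * k"
    using jacobsthal_1_mod_8 by (auto simp: cong_iff_dvd_diff elim: dvdE)
  define A where "A = 2 * int m - 1 + 4 * k"
  have A: "jacobsthal 1 = 2 * A" using k by (simp add: A_def)
  have "even ((jacobsthal (int g))\<^sup>2)"
  proof -
    have "(jacobsthal (int g))\<^sup>2 = 2 * (2 * int p - 2 * A\<^sup>2)"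
      using sum A by (simp add: power_mult_distrib)
    thus ?thesis by simp
  qed
  then obtain B where B: "jacobsthal (int g) = 2 * B" by auto
  have "int p = A\<^sup>2 + B\<^sup>2" using sum A B by (simp add: power_mult_distrib)
  moreover have "odd A" by (simp add: A_def)
  moreover have "odd a" using a by presburger
  ultimately have "A\<^sup>2 = a\<^sup>2"
    using prime_two_squares_unique[OF prime_int _ _ ab] odd_p by (metis even_of_nat)
  hence "A = a \<or> A = - a" by (simp add: power2_eq_iff)
  moreover obtain l where "a - 1 = 4 * l" using a by (elim dvdE)
  ultimately have "A = - ((-1) ^ m) * a"
    by (cases "even m"; simp add: A_def; presburger)
  with A show ?thesis by simp
qed

end

subsection \<open>The Jacobsthal sum modulo the square of a prime\<close>

text \<open>In x^p - y^p = (x - y) * cofactor, the cofactor is congruent modulo p to p copies of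
  y^(p-1), hence to 0.\<close>

lemma cong_power_lift:
  fixes x y :: int
  assumes "[x = y] (mod int p)"
  shows "[x ^ p = y ^ p] (mod (int p)\<^sup>2)"
proof -
  have "[(\<Sum>i<p. y ^ (p - Suc i) * x ^ i) = (\<Sum>i<p. y ^ (p - Suc i) * y ^ i)] (mod int p)"
    by (intro cong_sum cong_mult cong_pow cong_refl assms)
  also have "(\<Sum>i<p. y ^ (p - Suc i) * y ^ i) = (\<Sum>i<p. y ^ (p - 1))"
    by (intro sum.cong refl) (simp flip: power_add)
  finally have "int p dvd (\<Sum>i<p. y ^ (p - Suc i) * x ^ i)"
    by (simp add: cong_dvd_iff)
  hence "int p * int p dvd (x - y) * (\<Sum>i<p. y ^ (p - Suc i) * x ^ i)"
    using assms by (intro mult_dvd_mono) (simp add: cong_iff_dvd_diff)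
  thus ?thesis
    by (simp add: power_diff_sumr2[symmetric] cong_iff_dvd_diff power2_eq_square)
qed

section \<open>Binomial coefficients with upper index a multiple of p, modulo p^2\<close>

lemma prime_dvd_choose_mult:
  fixes p :: nat
  assumes "prime p" "\<not> p dvd k"
  shows "p dvd (p * n choose k)"
proof -
  have "k > 0" using assms(2) by (intro Nat.gr0I) auto
  hence "k * (p * n choose k) = p * n * (p * n - 1 choose (k - 1))"
    by (rule times_binomial_minus1_eq)
  hence "p dvd k * (p * n choose k)" by simp
  thus ?thesis using assms by (simp add: prime_dvd_mult_iff)
qed

text \<open>In Vandermonde's convolution for \<open>p * n + p\<close> all terms but these have two factors
  divisible by \<open>p\<close>.\<close>

lemma choose_mult_Suc_cong:
  fixes p :: nat
  assumes p: "prime p"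
  shows "[p * Suc n choose s = (p * n choose s) + (if p \<le> s then p * n choose (s - p) else 0)
      + (if p dvd s then 0 else (p choose (s mod p)) * (p * n choose (s - s mod p)))] (mod p\<^sup>2)"
proof -
  define f where "f k = (p choose k) * (p * n choose (s - k))" for k
  have r: "s mod p < p" using p by (simp add: prime_gt_0_nat)
  have "p * Suc n choose s = (\<Sum>k\<le>s. f k)"
    using vandermonde[of p "p * n" s] by (simp add: f_def)
  also have "[(\<Sum>k\<le>s. f k) = (\<Sum>k\<le>s. if k \<in> {0, p, s mod p} then f k else 0)] (mod p\<^sup>2)"
  proof (rule cong_sum)
    fix k assume "k \<in> {..s}"
    hence ks: "k \<le> s" by simp
    show "[f k = (if k \<in> {0, p, s mod p} then f k else 0)] (mod p\<^sup>2)"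
    proof (cases "k \<in> {0, p, s mod p}")
      case False
      show ?thesis
      proof (cases "k > p")
        case True
        thus ?thesis by (simp add: f_def binomial_eq_0)
      next
        case kp: False
        hence "0 < k" "k < p" using False by auto
        hence "p dvd (p choose k)" by (intro dvd_choose_prime p) auto
        moreover have "\<not> p dvd s - k"
        proof
          assume "p dvd s - k"
          hence "s mod p = k mod p" using ks by (metis mod_eq_dvd_iff_nat)
          with \<open>k < p\<close> False show False by simp
        qed
        ultimately have "p * p dvd f k"
          unfolding f_def using p by (intro mult_dvd_mono prime_dvd_choose_mult)
        thus ?thesis using False by (simp add: cong_0_iff power2_eq_square)
      qed
    qed simp
  qed
  also have "(\<Sum>k\<le>s. if k \<in> {0, p, s mod p} then f k else 0) = (\<Sum>k\<in>{..s} \<inter> {0, p, s mod p}. f k)"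
    by (subst sum.inter_restrict) auto
  \<comment> \<open>If p divides s, then \<open>s mod p\<close> is the index 0, which must not be
    counted twice.\<close>
  also have "{..s} \<inter> {0, p, s mod p} =
      {0} \<union> ((if p \<le> s then {p} else {}) \<union> (if p dvd s then {} else {s mod p}))"
    by (auto simp: dvd_eq_mod_eq_0)
  also have "(\<Sum>k\<in>\<dots>. f k) = f 0 + ((if p \<le> s then f p else 0) + (if p dvd s then 0 else f (s mod p)))"
    using r by (auto simp: dvd_eq_mod_eq_0)
  also have "\<dots> = (p * n choose s) + (if p \<le> s then p * n choose (s - p) else 0)
      + (if p dvd s then 0 else (p choose (s mod p)) * (p * n choose (s - s mod p)))"
    by (simp add: f_def)
  finally show ?thesis .
qed

text \<open>At multiples of p the recurrence above is Pascal's rule.\<close>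

lemma choose_mult_mult_cong:
  fixes p :: nat
  assumes p: "prime p"
  shows "[p * n choose (p * i) = n choose i] (mod p\<^sup>2)"
proof (induction n arbitrary: i)
  case 0
  show ?case using p by (cases i) (auto simp: prime_gt_0_nat binomial_eq_0)
next
  case (Suc n)
  show ?case
  proof (cases i)
    case (Suc l)
    have "[p * Suc n choose (p * i) = (p * n choose (p * i)) + (p * n choose (p * l))] (mod p\<^sup>2)"
      using choose_mult_Suc_cong[OF p, of n "p * i"] Suc by simp
    also have "[(p * n choose (p * i)) + (p * n choose (p * l)) = (n choose i) + (n choose l)] (mod p\<^sup>2)"
      by (intro cong_add Suc.IH)
    finally show ?thesis using Suc by (simp add: add.commute)
  qed simp
qed

text \<open>(1 + X)^p is 1 + X^p plus a remainder divisible by p, so to first order (1 + X)^(pn) is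
  (1 + X^p)^n plus n (1 + X^p)^(n-1) times the remainder. The claim compares coefficients of
  X^(pi+r); the induction obtains it from the recurrence.\<close>

lemma choose_mult_add_cong:
  fixes p :: nat
  assumes p: "prime p" and r: "0 < r" "r < p"
  shows "[p * n choose (p * i + r) = n * (n - 1 choose i) * (p choose r)] (mod p\<^sup>2)"
proof (induction n arbitrary: i)
  case 0
  show ?case using r by (simp add: binomial_eq_0)
next
  case (Suc n)
  let ?c = "p choose r"
  have c1: "[?c * (p * n choose (p * i)) = ?c * (n choose i)] (mod p\<^sup>2)"
    by (intro cong_scalar_left choose_mult_mult_cong p)
  have "\<not> p dvd r" using r by (auto dest: dvd_imp_le)
  hence step: "[p * Suc n choose (p * i + r) = (p * n choose (p * i + r))
      + (if p \<le> p * i + r then p * n choose (p * i + r - p) else 0) + ?c * (p * n choose (p * i))] (mod p\<^sup>2)"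
  proof -
    have "\<not> p dvd p * i + r" "(p * i + r) mod p = r" "p * i + r - r = p * i"
      using r \<open>\<not> p dvd r\<close> by (simp_all add: dvd_add_right_iff)
    thus ?thesis using choose_mult_Suc_cong[OF p, of n "p * i + r"] by (simp only: if_False)
  qed
  show ?case
  proof (cases i)
    case 0
    have "[p * Suc n choose (p * i + r) = (p * n choose (p * i + r)) + ?c * (p * n choose (p * i))] (mod p\<^sup>2)"
      using step r 0 by simp
    also have "[(p * n choose (p * i + r)) + ?c * (p * n choose (p * i))
        = n * (n - 1 choose i) * ?c + ?c * (n choose i)] (mod p\<^sup>2)"
      by (intro cong_add Suc.IH c1)
    finally show ?thesis using 0 by (simp add: algebra_simps)
  next
    case (Suc l)
    hence *: "p \<le> p * i + r" "p * i + r - p = p * l + r" by simp_all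
    have "[p * Suc n choose (p * i + r) = (p * n choose (p * i + r)) + (p * n choose (p * l + r))
        + ?c * (p * n choose (p * i))] (mod p\<^sup>2)"
      using step by (simp only: * if_True)
    also have "[(p * n choose (p * i + r)) + (p * n choose (p * l + r)) + ?c * (p * n choose (p * i))
        = n * (n - 1 choose i) * ?c + n * (n - 1 choose l) * ?c + ?c * (n choose i)] (mod p\<^sup>2)"
      by (intro cong_add Suc.IH c1)
    also have "n * (n - 1 choose i) * ?c + n * (n - 1 choose l) * ?c + ?c * (n choose i)
        = Suc n * (n choose i) * ?c"
      using Suc by (cases n) (simp_all add: algebra_simps)
    finally show ?thesis by simp
  qed
qed

lemma sum_lessThan_odd_split:
  fixes f :: "nat \<Rightarrow> 'a::comm_monoid_add"
  shows "(\<Sum>k<2 * n + 1. f k) = (\<Sum>i\<le>n. f (2 * i)) + (\<Sum>i<n. f (2 * i + 1))"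
  by (induction n) (simp_all add: ac_simps)

lemma sum_atMost_symmetric:
  fixes f :: "nat \<Rightarrow> nat"
  assumes "\<And>i. i < m \<Longrightarrow> f (2 * m - i) = f i"
  shows "(\<Sum>i\<le>2 * m. f i) = f m + 2 * (\<Sum>i<m. f i)"
proof -
  have upper: "f (2 * m - a) = f a" if "m < a" "a \<le> 2 * m" for a
    using assms[of "2 * m - a"] that by simp
  have "{..2 * m} = insert m ({..<m} \<union> {m<..2 * m})" by auto
  moreover have "(\<Sum>i\<in>{m<..2 * m}. f i) = (\<Sum>i<m. f i)"
    by (rule sum.reindex_bij_witness[of _ "\<lambda>i. 2 * m - i" "\<lambda>i. 2 * m - i"]) (auto simp: upper)
  moreover have "(\<Sum>i\<in>{..<m} \<union> {m<..2 * m}. f i) = (\<Sum>i<m. f i) + (\<Sum>i\<in>{m<..2 * m}. f i)"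
    by (rule sum.union_disjoint) auto
  ultimately show ?thesis by simp
qed

section \<open>Expansion of the Jacobsthal sum into binomial coefficients\<close>

context prime_1_mod_4
begin

text \<open>Euler's criterion raised to the power p, which gains a factor p in the modulus and
  leaves the values 0, 1, -1 unchanged. The representative \<open>y\<close> may be any integer
  congruent to \<open>z\<close> modulo p.\<close>

lemma chi_lift:
  assumes "[z = y] (mod int p)"
  shows "[\<chi> z = y ^ (2 * m * p)] (mod (int p)\<^sup>2)"
proof -
  have "(p - 1) div 2 = 2 * m" using p_eq by simp
  hence "[\<chi> z = y ^ (2 * m)] (mod int p)" using euler[of y] chi_cong[OF assms] by simp
  hence "[\<chi> z ^ p = (y ^ (2 * m)) ^ p] (mod (int p)\<^sup>2)" by (rule cong_power_lift)
  moreover have "\<chi> z ^ p = \<chi> z"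
    using chi_cases[of z] odd_p by (auto simp: p_eq)
  ultimately show ?thesis by (simp add: power_mult)
qed

text \<open>g^p has order p - 1 modulo p^2, so the ratio h satisfies h^(4m) = 1 there, and the
  geometric sum vanishes once h - 1 can be cancelled.\<close>

lemma primroot_geometric_sum_cong:
  assumes g: "residue_primroot p g"
  shows "[(\<Sum>j<4 * m. (int g ^ (p * s)) ^ j) = (if 4 * m dvd s then 4 * int m else 0)] (mod (int p)\<^sup>2)"
proof -
  define h where "h = int g ^ (p * s)"
  have h: "h = (int g ^ s) ^ p" by (simp add: h_def mult.commute flip: power_mult)
  have iff: "[int g ^ s = 1] (mod int p) \<longleftrightarrow> 4 * m dvd s"
    using primroot_power_cong_1_iff[OF g] p_eq by simp
  show ?thesis
  proof (cases "4 * m dvd s")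
    case True
    hence "[h = 1 ^ p] (mod (int p)\<^sup>2)"
      unfolding h by (intro cong_power_lift) (simp add: iff)
    hence "[(\<Sum>j<4 * m. h ^ j) = (\<Sum>j<4 * m. (1 ^ p) ^ j)] (mod (int p)\<^sup>2)"
      by (intro cong_sum cong_pow)
    thus ?thesis using True by (simp add: h_def)
  next
    case False
    have "[(int g ^ (4 * m * s)) ^ p = 1 ^ p] (mod (int p)\<^sup>2)"
      by (rule cong_power_lift) (use primroot_power_cong_1_iff[OF g] p_eq in simp)
    moreover have "(int g ^ (4 * m * s)) ^ p = h ^ (4 * m)"
      by (simp add: h_def power_mult[symmetric] mult_ac)
    ultimately have "(int p)\<^sup>2 dvd h ^ (4 * m) - 1" by (simp add: cong_iff_dvd_diff)
    hence "(int p)\<^sup>2 dvd (h - 1) * (\<Sum>j<4 * m. h ^ j)" by (simp add: power_diff_1_eq)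
    \<comment> \<open>That h differs from 1 modulo p^2 would not allow cancelling. But h is g^s
      modulo p, hence differs from 1 even modulo p.\<close>
    moreover have "coprime ((int p)\<^sup>2) (h - 1)"
    proof -
      have "[h = int g ^ s * (int g ^ s) ^ (4 * m)] (mod int p)"
        by (simp add: h p_eq)
      also have "[int g ^ s * (int g ^ s) ^ (4 * m) = int g ^ s * 1] (mod int p)"
        by (intro cong_mult cong_refl) (use primroot_power_cong_1_iff[OF g, of "s * (4 * m)"] p_eq in \<open>simp add: power_mult\<close>)
      finally have "[h = 1] (mod int p) \<longleftrightarrow> [int g ^ s = 1] (mod int p)"
        by (simp add: cong_def)
      hence "\<not> int p dvd h - 1" using False iff by (simp add: cong_iff_dvd_diff)
      hence "coprime (h - 1) (int p)" by (rule coprime_iff[THEN iffD2])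
      thus ?thesis by (simp add: coprime_commute)
    qed
    ultimately have "(int p)\<^sup>2 dvd (\<Sum>j<4 * m. h ^ j)"
      by (simp add: coprime_dvd_mult_right_iff)
    thus ?thesis using False by (simp add: h_def cong_0_iff)
  qed
qed

lemma jacobsthal_1_cong_choose:
  "[jacobsthal 1 = 4 * int m * (-1) ^ m * int (\<Sum>k<p. 2 * m * p choose (m + 2 * m * k))] (mod (int p)\<^sup>2)"
proof -
  obtain g where g: "residue_primroot p g" using ex_primroot by blast
  define G where "G = int g"
  define N where "N = 2 * m * p"
  \<comment> \<open>Modulo p the base G can be exchanged for G^p, whose powers are roots of unity
    modulo p^2.\<close>
  have Gp: "[G = G ^ p] (mod int p)"
  proof -
    have "[G * 1 = G * G ^ (4 * m)] (mod int p)"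
      using primroot_power_cong_1_iff[OF g, of "4 * m"] p_eq
      by (intro cong_mult cong_refl) (simp add: G_def cong_sym)
    thus ?thesis by (simp add: p_eq)
  qed
  have "jacobsthal 1 = (\<Sum>j<4 * m. \<chi> (G ^ j * ((G ^ j)\<^sup>2 - 1)))"
    using jacobsthal_1_primroot[OF g] by (simp add: chi_mult G_def)
  also have "[\<dots> = (\<Sum>j<4 * m. \<Sum>k\<le>N. (-1) ^ k * int (N choose k) * (G ^ (p * (N + 2 * k))) ^ j)] (mod (int p)\<^sup>2)"
  proof (rule cong_sum)
    fix j
    define H where "H = (G ^ p) ^ j"
    have "[\<chi> (G ^ j * ((G ^ j)\<^sup>2 - 1)) = (H * (H\<^sup>2 - 1)) ^ N] (mod (int p)\<^sup>2)"
      unfolding N_def H_def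
      by (intro chi_lift cong_mult cong_diff cong_pow cong_refl Gp)
    also have "(H * (H\<^sup>2 - 1)) ^ N = H ^ N * (H\<^sup>2 + (-1)) ^ N"
      by (simp add: power_mult_distrib)
    also have "\<dots> = (\<Sum>k\<le>N. H ^ N * (int (N choose k) * (H\<^sup>2) ^ k * (-1) ^ (N - k)))"
      by (simp only: binomial_ring sum_distrib_left)
    also have "\<dots> = (\<Sum>k\<le>N. (-1) ^ k * int (N choose k) * (G ^ (p * (N + 2 * k))) ^ j)"
    proof (rule sum.cong[OF refl])
      fix k assume "k \<in> {..N}"
      moreover have "even N" by (simp add: N_def)
      ultimately have "(-1 :: int) ^ (N - k) = (-1) ^ k" by (cases "even k") auto
      moreover have "H ^ N * (H\<^sup>2) ^ k = (G ^ (p * (N + 2 * k))) ^ j"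
      proof -
        have "H ^ N * (H\<^sup>2) ^ k = H ^ (N + 2 * k)" by (simp add: power_add power_mult)
        also have "\<dots> = (G ^ (p * (N + 2 * k))) ^ j"
          unfolding H_def by (simp only: power_mult[symmetric] mult_ac)
        finally show ?thesis .
      qed
      ultimately show "H ^ N * (int (N choose k) * (H\<^sup>2) ^ k * (-1) ^ (N - k)) =
          (-1) ^ k * int (N choose k) * (G ^ (p * (N + 2 * k))) ^ j"
        by (simp add: mult_ac)
    qed
    finally show "[\<chi> (G ^ j * ((G ^ j)\<^sup>2 - 1)) =
        (\<Sum>k\<le>N. (-1) ^ k * int (N choose k) * (G ^ (p * (N + 2 * k))) ^ j)] (mod (int p)\<^sup>2)" .
  qed
  also have "(\<Sum>j<4 * m. \<Sum>k\<le>N. (-1) ^ k * int (N choose k) * (G ^ (p * (N + 2 * k))) ^ j) =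
      (\<Sum>k\<le>N. (-1) ^ k * int (N choose k) * (\<Sum>j<4 * m. (G ^ (p * (N + 2 * k))) ^ j))"
    by (subst sum.swap) (simp add: sum_distrib_left)
  also have "[\<dots> = (\<Sum>k\<le>N. (-1) ^ k * int (N choose k) *
      (if 4 * m dvd N + 2 * k then 4 * int m else 0))] (mod (int p)\<^sup>2)"
    unfolding G_def by (intro cong_sum cong_mult cong_refl primroot_geometric_sum_cong g)
  also have "(\<Sum>k\<le>N. (-1) ^ k * int (N choose k) * (if 4 * m dvd N + 2 * k then 4 * int m else 0))
      = (\<Sum>k<p. (-1) ^ m * int (N choose (m + 2 * m * k)) * (4 * int m))"
  proof -
    have dvd: "4 * m dvd N + 2 * k \<longleftrightarrow> (\<exists>l. k = m + 2 * m * l)" if "k \<le> N" for k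
    proof
      assume "4 * m dvd N + 2 * k"
      \<comment> \<open>Here N = 2m(4m + 1) = 8m^2 + 2m, so the condition is that 2m divides m +
        k.\<close>
      moreover have "N + 2 * k = 4 * m * (2 * m) + 2 * (m + k)"
        by (simp add: N_def p_eq algebra_simps)
      ultimately have "2 * (2 * m) dvd 2 * (m + k)"
        by (metis dvd_add_right_iff dvd_triv_left mult.assoc numeral_Bit0_eq_double)
      hence "2 * m dvd m + k" by (simp only: nat_mult_dvd_cancel_disj) simp
      then obtain q where q: "m + k = 2 * m * q" by (elim dvdE)
      with m_pos obtain l where l: "q = Suc l" by (cases q) auto
      have "k = m + 2 * m * l" using q unfolding l by simp
      thus "\<exists>l. k = m + 2 * m * l" ..
    next
      assume "\<exists>l. k = m + 2 * m * l"
      then obtain l where "k = m + 2 * m * l" ..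
      hence "N + 2 * k = 4 * m * (2 * m + 1 + l)" by (simp add: N_def p_eq algebra_simps)
      thus "4 * m dvd N + 2 * k" by simp
    qed
    have range: "m + 2 * m * l \<le> N \<longleftrightarrow> l < p" for l
    proof
      assume "m + 2 * m * l \<le> N"
      hence "2 * m * l < 2 * m * p" using m_pos unfolding N_def by linarith
      thus "l < p" by simp
    next
      assume "l < p"
      hence "2 * m * (l + 1) \<le> 2 * m * p" by (intro mult_le_mono2) simp
      thus "m + 2 * m * l \<le> N" by (simp add: N_def algebra_simps)
    qed
    have "inj_on (\<lambda>l. m + 2 * m * l) {..<p}" using m_pos by (auto simp: inj_on_def)
    moreover have "{k \<in> {..N}. 4 * m dvd N + 2 * k} = (\<lambda>l. m + 2 * m * l) ` {..<p}"
      using dvd range by auto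
    moreover have "(\<Sum>k\<le>N. (-1) ^ k * int (N choose k) * (if 4 * m dvd N + 2 * k then 4 * int m else 0))
      = (\<Sum>k\<in>{k \<in> {..N}. 4 * m dvd N + 2 * k}. (-1) ^ k * int (N choose k) * (4 * int m))"
      by (intro sum.mono_neutral_cong_right) auto
    ultimately show ?thesis by (simp add: sum.reindex power_add)
  qed
  finally show ?thesis by (simp add: N_def sum_distrib_left mult_ac)
qed

text \<open>Divide the lower index by p = 4m + 1: for k = 2i it is p i + (m - i), for k = 2i + 1 it
  is p i + (3m - i). Only k = 2m has remainder 0, and it gives the central coefficient.\<close>

lemma sum_choose_cong:
  "[(\<Sum>k<p. 2 * m * p choose (m + 2 * m * k)) = (2 * m choose m)
     + 2 * (\<Sum>i<m. 2 * m * (2 * m - 1 choose i) * (p choose (m - i)))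
     + (\<Sum>i<2 * m. 2 * m * (2 * m - 1 choose i) * (p choose (3 * m - i)))] (mod p\<^sup>2)"
proof -
  define f where "f k = (2 * m * p choose (m + 2 * m * k))" for k
  have even: "f (2 * i) = (p * (2 * m) choose (p * i + (m - i)))" if "i \<le> m" for i
  proof -
    have "m + 2 * m * (2 * i) = p * i + (m - i)" using that by (simp add: p_eq algebra_simps)
    thus ?thesis by (simp add: f_def mult.commute)
  qed
  have odd: "f (2 * i + 1) = (p * (2 * m) choose (p * i + (3 * m - i)))" if "i < 2 * m" for i
  proof -
    have "m + 2 * m * (2 * i + 1) = p * i + (3 * m - i)" using that by (simp add: p_eq algebra_simps)
    thus ?thesis by (simp add: f_def mult.commute)
  qed
  \<comment> \<open>For even k = 2i with i > m the number m - i is negative; these terms are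
    reflected to i < m, whence the factor 2.\<close>
  have sym: "f (2 * (2 * m - i)) = f (2 * i)" if i: "i < m" for i
  proof -
    have *: "m + 2 * m * (2 * (2 * m - i)) + (m + 2 * m * (2 * i)) = 2 * m * p"
    proof -
      have "2 * m * (2 * (2 * m - i)) + 2 * m * (2 * i) = 2 * m * (2 * (2 * m - i) + 2 * i)"
        by (simp only: add_mult_distrib2)
      also have "2 * (2 * m - i) + 2 * i = 4 * m" using i by simp
      finally show ?thesis by (simp add: p_eq)
    qed
    have "f (2 * (2 * m - i)) = (2 * m * p choose (2 * m * p - (m + 2 * m * (2 * (2 * m - i)))))"
      unfolding f_def using * by (intro binomial_symmetric) linarith
    also have "2 * m * p - (m + 2 * m * (2 * (2 * m - i))) = m + 2 * m * (2 * i)"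
      using * by linarith
    finally show ?thesis by (simp add: f_def)
  qed
  have "p = 2 * (2 * m) + 1" using p_eq by simp
  hence "(\<Sum>k<p. f k) = (\<Sum>i\<le>2 * m. f (2 * i)) + (\<Sum>i<2 * m. f (2 * i + 1))"
    by (simp only: sum_lessThan_odd_split)
  also have "(\<Sum>i\<le>2 * m. f (2 * i)) = f (2 * m) + 2 * (\<Sum>i<m. f (2 * i))"
    by (rule sum_atMost_symmetric[of m "\<lambda>i. f (2 * i)"]) (rule sym)
  finally have split: "(\<Sum>k<p. f k) = f (2 * m) + 2 * (\<Sum>i<m. f (2 * i)) + (\<Sum>i<2 * m. f (2 * i + 1))" .
  have "[(\<Sum>k<p. f k) =
     (2 * m choose m) + 2 * (\<Sum>i<m. 2 * m * (2 * m - 1 choose i) * (p choose (m - i)))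
     + (\<Sum>i<2 * m. 2 * m * (2 * m - 1 choose i) * (p choose (3 * m - i)))] (mod p\<^sup>2)"
    unfolding split
  proof (intro cong_add cong_mult cong_refl cong_sum)
    show "[f (2 * m) = 2 * m choose m] (mod p\<^sup>2)"
      using even[of m] choose_mult_mult_cong[OF prime, of "2 * m" m] by simp
  next
    fix i assume "i \<in> {..<m}"
    hence i: "i < m" by simp
    show "[f (2 * i) = 2 * m * (2 * m - 1 choose i) * (p choose (m - i))] (mod p\<^sup>2)"
      unfolding even[OF less_imp_le[OF i]]
      by (rule choose_mult_add_cong[OF prime]) (use i in \<open>auto simp: p_eq\<close>)
  next
    fix i assume "i \<in> {..<2 * m}"
    hence i: "i < 2 * m" by simp
    show "[f (2 * i + 1) = 2 * m * (2 * m - 1 choose i) * (p choose (3 * m - i))] (mod p\<^sup>2)"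
      unfolding odd[OF i]
      by (rule choose_mult_add_cong[OF prime]) (use i in \<open>auto simp: p_eq\<close>)
  qed
  thus ?thesis unfolding f_def .
qed

end

subsection \<open>Congruences between rationals\<close>

text \<open>The ring of rationals with denominators prime to \<open>m\<close>. With it a congruence
  becomes membership of the difference in \<open>m\<close> times this ring, and ring closure
  replaces explicit fractions.\<close>

definition integral_at :: "int \<Rightarrow> rat \<Rightarrow> bool" where
  "integral_at m x \<longleftrightarrow> (\<exists>c d. d \<noteq> 0 \<and> coprime d m \<and> x = of_int c / of_int d)"

lemma rat_cong_iff: "rat_cong x y m \<longleftrightarrow> (\<exists>z. integral_at m z \<and> x - y = of_int m * z)"
  unfolding rat_cong_def integral_at_def by metis

lemma integral_atI: "d \<noteq> 0 \<Longrightarrow> coprime d m \<Longrightarrow> x = of_int c / of_int d \<Longrightarrow> integral_at m x"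
  by (auto simp: integral_at_def)

lemma integral_at_of_int [simp]: "integral_at m (of_int c)"
  by (rule integral_atI[of 1 _ _ c]) auto

lemma integral_at_of_nat [simp]: "integral_at m (of_nat c)"
  using integral_at_of_int[of m "int c"] by simp

lemma integral_at_0 [simp]: "integral_at m 0" and integral_at_1 [simp]: "integral_at m 1"
  and integral_at_numeral [simp]: "integral_at m (numeral k)"
  using integral_at_of_int[of m 0] integral_at_of_int[of m 1] integral_at_of_int[of m "numeral k"]
  by simp_all

lemma integral_at_minus: "integral_at m x \<Longrightarrow> integral_at m (- x)"
  unfolding integral_at_def by (metis minus_divide_left of_int_minus)

lemma integral_at_add:
  assumes "integral_at m x" "integral_at m y"
  shows "integral_at m (x + y)"
proof -
  obtain a b where x: "b \<noteq> 0" "coprime b m" "x = of_int a / of_int b"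
    using assms by (auto simp: integral_at_def)
  obtain c d where y: "d \<noteq> 0" "coprime d m" "y = of_int c / of_int d"
    using assms by (auto simp: integral_at_def)
  show ?thesis
    by (rule integral_atI[of "b * d" _ _ "a * d + c * b"]) (use x y in \<open>auto simp: field_simps\<close>)
qed

lemma integral_at_mult:
  assumes "integral_at m x" "integral_at m y"
  shows "integral_at m (x * y)"
proof -
  obtain a b where x: "b \<noteq> 0" "coprime b m" "x = of_int a / of_int b"
    using assms by (auto simp: integral_at_def)
  obtain c d where y: "d \<noteq> 0" "coprime d m" "y = of_int c / of_int d"
    using assms by (auto simp: integral_at_def)
  show ?thesis
    by (rule integral_atI[of "b * d" _ _ "a * c"]) (use x y in auto)
qed

lemma integral_at_diff: "integral_at m x \<Longrightarrow> integral_at m y \<Longrightarrow> integral_at m (x - y)"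
  using integral_at_add[of m x "- y"] by (simp add: integral_at_minus)

lemma integral_at_power: "integral_at m x \<Longrightarrow> integral_at m (x ^ k)"
  by (induction k) (simp_all add: integral_at_mult)

lemma integral_at_sum: "(\<And>i. i \<in> A \<Longrightarrow> integral_at m (f i)) \<Longrightarrow> integral_at m (sum f A)"
  by (induction A rule: infinite_finite_induct) (simp_all add: integral_at_add)

lemma integral_at_divide_int:
  assumes "integral_at m x" "coprime d m"
  shows "integral_at m (x / of_int d)"
proof (cases "d = 0")
  case False
  hence "integral_at m (1 / of_int d)"
    by (intro integral_atI[of d _ _ 1]) (use assms in auto)
  from integral_at_mult[OF assms(1) this] show ?thesis by simp
qed simp

lemma integral_at_divide_nat:
  "integral_at m x \<Longrightarrow> coprime (int d) m \<Longrightarrow> integral_at m (x / of_nat d)"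
  using integral_at_divide_int[of m x "int d"] by simp

lemma integral_at_power_iff: "k > 0 \<Longrightarrow> integral_at (m ^ k) x \<longleftrightarrow> integral_at m x"
  by (simp add: integral_at_def)

lemma rat_cong_refl [simp]: "rat_cong x x m"
  unfolding rat_cong_iff by (intro exI[of _ 0]) simp

lemma rat_cong_sym: "rat_cong x y m \<Longrightarrow> rat_cong y x m"
  unfolding rat_cong_iff by (metis integral_at_minus minus_diff_eq mult_minus_right)

lemma rat_cong_add:
  assumes "rat_cong x y m" "rat_cong u v m"
  shows "rat_cong (x + u) (y + v) m"
proof -
  obtain z where "integral_at m z" "x - y = of_int m * z" using assms by (auto simp: rat_cong_iff)
  moreover obtain w where "integral_at m w" "u - v = of_int m * w" using assms by (auto simp: rat_cong_iff)
  moreover have "x + u - (y + v) = (x - y) + (u - v)" by simp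
  ultimately show ?thesis
    unfolding rat_cong_iff by (intro exI[of _ "z + w"]) (simp add: integral_at_add distrib_left)
qed

lemma rat_cong_trans [trans]:
  assumes "rat_cong x y m" "rat_cong y z m"
  shows "rat_cong x z m"
  using rat_cong_add[OF assms] by (auto simp: rat_cong_iff)

lemma rat_cong_sum: "(\<And>i. i \<in> A \<Longrightarrow> rat_cong (f i) (g i) m) \<Longrightarrow> rat_cong (sum f A) (sum g A) m"
  by (induction A rule: infinite_finite_induct) (simp_all add: rat_cong_add)

lemma rat_cong_scale:
  assumes "rat_cong x y m" "integral_at m u"
  shows "rat_cong (u * x) (u * y) m"
proof -
  obtain z where "integral_at m z" "x - y = of_int m * z" using assms by (auto simp: rat_cong_iff)
  moreover have "u * x - u * y = u * (x - y)" by (simp add: right_diff_distrib)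
  ultimately show ?thesis
    unfolding rat_cong_iff by (intro exI[of _ "u * z"]) (simp add: integral_at_mult assms)
qed

lemma rat_cong_diff: "rat_cong x y m \<Longrightarrow> rat_cong u v m \<Longrightarrow> rat_cong (x - u) (y - v) m"
  using rat_cong_add[of x y m "-1 * u" "-1 * v"] rat_cong_scale[of u v m "-1"]
  by (simp add: integral_at_minus)

lemma rat_cong_of_int: "[a = b] (mod m) \<Longrightarrow> rat_cong (of_int a) (of_int b) m"
proof -
  assume "[a = b] (mod m)"
  then obtain k where "a - b = m * k" by (auto simp: cong_iff_dvd_diff elim: dvdE)
  hence "of_int a - of_int b = (of_int m * of_int k :: rat)"
    by (simp flip: of_int_diff of_int_mult)
  thus ?thesis unfolding rat_cong_iff by (intro exI[of _ "of_int k"]) simp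
qed

lemma rat_cong_of_nat: "[a = b] (mod m) \<Longrightarrow> rat_cong (of_nat a) (of_nat b) (int m)"
  using rat_cong_of_int[of "int a" "int b" "int m"] by (simp add: cong_int_iff)

lemma rat_cong_inverse_int:
  assumes "[a = b] (mod m)" "coprime a m" "a \<noteq> 0" "b \<noteq> 0"
  shows "rat_cong (1 / of_int a) (1 / of_int b) m"
proof -
  obtain k where k: "a - b = m * k" using assms(1) by (auto simp: cong_iff_dvd_diff elim: dvdE)
  have "coprime b m" using assms(1,2) by (metis cong_imp_coprime)
  show ?thesis
    unfolding rat_cong_def
  proof (intro exI conjI)
    show "a * b \<noteq> 0" "coprime (a * b) m" using assms \<open>coprime b m\<close> by auto
    have "1 / of_int a - 1 / of_int b = (- of_int (a - b) / of_int (a * b) :: rat)"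
      using assms by (simp add: field_simps)
    thus "1 / of_int a - 1 / of_int b = (of_int m * (of_int (- k) / of_int (a * b)) :: rat)"
      by (simp add: k)
  qed
qed

text \<open>A term carrying a factor p needs to be known only modulo p; all correction terms are
  treated this way.\<close>

lemma rat_cong_mult_modulus:
  assumes "rat_cong x y (int p)"
  shows "rat_cong (of_nat p * x) (of_nat p * y) ((int p)\<^sup>2)"
proof -
  obtain z where z: "integral_at (int p) z" "x - y = of_nat p * z"
    using assms by (auto simp: rat_cong_iff)
  have "of_nat p * x - of_nat p * y = of_nat p * (x - y)" by (simp add: right_diff_distrib)
  thus ?thesis using z
    unfolding rat_cong_iff by (intro exI[of _ z]) (simp add: integral_at_power_iff, simp add: power2_eq_square)
qed

subsection \<open>Reduction to a Legendre polynomial\<close>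

text \<open>Both sides are the Legendre polynomial P_n at 1 + 2y. Expanding (1 + y)^j, the
  coefficient of y^(n-i) is evaluated by Vandermonde's convolution.\<close>

lemma sum_choose_choose_power:
  fixes y :: "'a::comm_semiring_1"
  shows "(\<Sum>k\<le>n. of_nat (n choose k) * of_nat (n + k choose k) * y ^ k) =
    (\<Sum>j\<le>n. (of_nat (n choose j))\<^sup>2 * (1 + y) ^ j * y ^ (n - j))"
proof -
  have coeff: "(\<Sum>j\<le>n. (n choose j)\<^sup>2 * (j choose i)) = (n choose i) * (2 * n - i choose n)"
    if i: "i \<le> n" for i
  proof -
    have "(\<Sum>j\<le>n. (n choose j)\<^sup>2 * (j choose i)) =
        (\<Sum>j\<le>n. (n choose i) * ((n choose j) * (n - i choose (n - j))))"
    proof (rule sum.cong[OF refl])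
      fix j assume "j \<in> {..n}"
      hence j: "j \<le> n" by simp
      show "(n choose j)\<^sup>2 * (j choose i) = (n choose i) * ((n choose j) * (n - i choose (n - j)))"
      proof (cases "i \<le> j")
        case True
        have "(n choose j) * (j choose i) = (n choose i) * (n - i choose (j - i))"
          using choose_mult[OF True j] .
        also have "n - i choose (j - i) = n - i choose (n - i - (j - i))"
          using True j by (intro binomial_symmetric) simp
        also have "n - i - (j - i) = n - j" using True j by simp
        finally show ?thesis by (simp add: power2_eq_square mult_ac)
      next
        case False
        thus ?thesis using i by (simp add: binomial_eq_0)
      qed
    qed
    also have "\<dots> = (n choose i) * (\<Sum>j\<le>n. (n choose j) * (n - i choose (n - j)))"
      by (simp add: sum_distrib_left)
    also have "(\<Sum>j\<le>n. (n choose j) * (n - i choose (n - j))) = (n + (n - i) choose n)"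
      by (rule vandermonde)
    finally show ?thesis using i by (simp add: mult_2)
  qed
  have "(\<Sum>j\<le>n. (of_nat (n choose j))\<^sup>2 * (1 + y) ^ j * y ^ (n - j)) =
      (\<Sum>j\<le>n. \<Sum>i\<le>n. of_nat ((n choose j)\<^sup>2 * (j choose i)) * y ^ (n - i))"
  proof (rule sum.cong[OF refl])
    fix j assume j: "j \<in> {..n}"
    have "(of_nat (n choose j))\<^sup>2 * (1 + y) ^ j * y ^ (n - j) =
        (\<Sum>i\<le>j. (of_nat (n choose j))\<^sup>2 * of_nat (j choose i) * (y ^ (j - i) * y ^ (n - j)))"
      unfolding binomial_ring by (simp add: sum_distrib_left sum_distrib_right mult_ac)
    also have "\<dots> = (\<Sum>i\<le>j. of_nat ((n choose j)\<^sup>2 * (j choose i)) * y ^ (n - i))"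
      using j by (intro sum.cong refl) (simp flip: power_add)
    also have "\<dots> = (\<Sum>i\<le>n. of_nat ((n choose j)\<^sup>2 * (j choose i)) * y ^ (n - i))"
      using j by (intro sum.mono_neutral_left) (auto simp: binomial_eq_0)
    finally show "(of_nat (n choose j))\<^sup>2 * (1 + y) ^ j * y ^ (n - j) =
        (\<Sum>i\<le>n. of_nat ((n choose j)\<^sup>2 * (j choose i)) * y ^ (n - i))" .
  qed
  also have "\<dots> = (\<Sum>i\<le>n. of_nat (\<Sum>j\<le>n. (n choose j)\<^sup>2 * (j choose i)) * y ^ (n - i))"
    by (subst sum.swap) (simp add: sum_distrib_right)
  also have "\<dots> = (\<Sum>i\<le>n. of_nat ((n choose i) * (2 * n - i choose n)) * y ^ (n - i))"
    by (intro sum.cong refl) (simp add: coeff)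
  also have "\<dots> = (\<Sum>k\<le>n. of_nat (n choose k) * of_nat (n + k choose k) * y ^ k)"
  proof (rule sum.reindex_bij_witness[of _ "\<lambda>k. n - k" "\<lambda>k. n - k"])
    fix i assume "i \<in> {..n}"
    hence i: "i \<le> n" by simp
    have "n choose (n - i) = n choose i" using i by (simp add: binomial_symmetric[symmetric])
    moreover have "n + (n - i) choose (n - i) = 2 * n - i choose n"
    proof -
      have "n + (n - i) = 2 * n - i" "2 * n - i - n = n - i" "n \<le> 2 * n - i" using i by simp_all
      thus ?thesis using binomial_symmetric[of n "2 * n - i"] by simp
    qed
    ultimately show "of_nat (n choose (n - i)) * of_nat (n + (n - i) choose (n - i)) * y ^ (n - i) =
        of_nat ((n choose i) * (2 * n - i choose n)) * y ^ (n - i)" by simp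
  qed auto
  finally show ?thesis ..
qed

text \<open>Coefficient of \<open>X\<^sup>n\<close> in \<open>(1 - X)\<^sup>n * (1 + X)\<^sup>n = (1 - X\<^sup>2)\<^sup>n\<close>.\<close>

lemma sum_alternating_choose_square:
  "(\<Sum>j\<le>n. (-1) ^ j * (int (n choose j))\<^sup>2) = (if even n then (-1) ^ (n div 2) * int (n choose (n div 2)) else 0)"
proof -
  have "(\<Sum>j\<le>n. (-1) ^ j * (int (n choose j))\<^sup>2) =
      (\<Sum>j\<le>n. coeff ([:1, -1:] ^ n) j * coeff (([:1, 1:] :: int poly) ^ n) (n - j))"
    by (intro sum.cong refl)
       (simp add: coeff_linear_poly_power power2_eq_square binomial_symmetric[symmetric])
  also have "\<dots> = coeff ([:1, -1:] ^ n * [:1, 1:] ^ n) n"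
    by (simp add: coeff_mult)
  also have "[:1, -1:] ^ n * ([:1, 1:] :: int poly) ^ n = (monom (-1) 2 + 1) ^ n"
  proof -
    have "[:1, -1:] * ([:1, 1:] :: int poly) = monom (-1) 2 + 1"
      by (simp add: monom_altdef power2_eq_square one_pCons)
    thus ?thesis by (simp only: flip: power_mult_distrib)
  qed
  also have "\<dots> = (\<Sum>k\<le>n. of_nat (n choose k) * monom ((-1) ^ k) (2 * k))"
    by (subst binomial_ring) (simp add: monom_power mult.commute)
  also have "coeff \<dots> n = (\<Sum>k\<le>n. if 2 * k = n then int (n choose k) * (-1) ^ k else 0)"
    unfolding coeff_sum by (intro sum.cong refl) (simp add: of_nat_poly)
  also have "\<dots> = (if even n then (-1) ^ (n div 2) * int (n choose (n div 2)) else 0)"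
  proof (cases "even n")
    case True
    then obtain l where l: "n = 2 * l" by (elim evenE)
    show ?thesis by (simp add: l)
  next
    case False
    hence "2 * k \<noteq> n" for k by auto
    thus ?thesis using False by simp
  qed
  finally show ?thesis .
qed

text \<open>The sum is the value of the Legendre polynomial \<open>P\<^sub>n\<close> at \<open>0\<close>.\<close>

lemma sum_legendre_zero:
  "(\<Sum>k\<le>n. of_nat (n choose k) * of_nat (n + k choose k) * (-1/2) ^ k :: rat) =
    (if even n then (-1) ^ (n div 2) * of_nat (n choose (n div 2)) / 2 ^ n else 0)"
proof -
  have "(\<Sum>k\<le>n. of_nat (n choose k) * of_nat (n + k choose k) * (-1/2) ^ k :: rat) =
      (\<Sum>j\<le>n. (of_nat (n choose j))\<^sup>2 * (1 + (-1/2)) ^ j * (-1/2) ^ (n - j))"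
    by (rule sum_choose_choose_power)
  also have "\<dots> = (\<Sum>j\<le>n. (-1) ^ n / 2 ^ n * of_int ((-1) ^ j * (int (n choose j))\<^sup>2))"
  proof (rule sum.cong[OF refl])
    fix j assume "j \<in> {..n}"
    hence n: "n = j + (n - j)" by simp
    have "(-1) ^ n * (-1 :: rat) ^ j = (-1) ^ (n - j)"
      by (subst n) (simp add: power_add flip: power_mult_distrib)
    moreover have "(2 :: rat) ^ n = 2 ^ j * 2 ^ (n - j)"
      by (subst n) (simp only: power_add)
    moreover have "(-1/2 :: rat) ^ (n - j) = (-1) ^ (n - j) / 2 ^ (n - j)"
      by (simp only: power_divide)
    moreover have "(1 + (-1/2) :: rat) ^ j = 1 / 2 ^ j" by (simp add: power_divide)
    ultimately show "(of_nat (n choose j))\<^sup>2 * (1 + (-1/2)) ^ j * (-1/2) ^ (n - j) =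
        ((-1) ^ n / 2 ^ n * of_int ((-1) ^ j * (int (n choose j))\<^sup>2) :: rat)"
      by (simp only:) (simp add: mult_ac)
  qed
  also have "\<dots> = (-1) ^ n / 2 ^ n * of_int (\<Sum>j\<le>n. (-1) ^ j * (int (n choose j))\<^sup>2)"
    by (simp add: sum_distrib_left)
  finally show ?thesis
    by (simp add: sum_alternating_choose_square)
qed

context odd_prime
begin

text \<open>Compare successive quotients: on the left (n+k+1)(n-k) appears, on the right -(2k+1)^2 /
  4. By 2n + 1 = p these differ by p^2 / 4.\<close>

lemma choose_central_cong:
  assumes "2 * n + 1 = p" "k \<le> n"
  shows "[int (n + k choose (2 * k)) * (-16) ^ k = int (2 * k choose k)] (mod (int p)\<^sup>2)"
  using assms(2)
proof (induction k)
  case (Suc k)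
  let ?A = "int (n + k choose (2 * k))" and ?B = "int (2 * k choose k)"
  let ?A' = "int (n + Suc k choose (2 * Suc k))" and ?B' = "int (2 * Suc k choose Suc k)"
  let ?d = "(2 * int k + 1) * (2 * int k + 2)"
  have A: "?d * ?A' = (int n + int k + 1) * (int n - int k) * ?A"
  proof -
    let ?E = "n + k choose (2 * k + 1)"
    have 1: "(2 * k + 2) * (n + Suc k choose (2 * Suc k)) = (n + k + 1) * ?E"
      using binomial_absorption[of "2 * k + 1" "Suc (n + k)"]
      by (simp only: add_Suc_right mult_Suc_right diff_Suc_1 Suc_eq_plus1[symmetric]) simp
    have 2: "(2 * k + 1) * ?E = (n - k) * (n + k choose (2 * k))"
    proof -
      have "(2 * k + 1) * ?E = (n + k - 2 * k) * (n + k choose (2 * k))"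
        by (metis Suc_eq_plus1 binomial_absorption binomial_absorb_comp)
      thus ?thesis by simp
    qed
    have "(2 * k + 1) * (2 * k + 2) * (n + Suc k choose (2 * Suc k)) =
        (2 * k + 1) * ((2 * k + 2) * (n + Suc k choose (2 * Suc k)))" by (rule mult.assoc)
    also have "\<dots> = (n + k + 1) * ((2 * k + 1) * ?E)" unfolding 1 by (rule mult.left_commute)
    also have "\<dots> = (n + k + 1) * ((n - k) * (n + k choose (2 * k)))" unfolding 2 ..
    finally have "int ((2 * k + 1) * (2 * k + 2) * (n + Suc k choose (2 * Suc k))) =
        int ((n + k + 1) * ((n - k) * (n + k choose (2 * k))))" by (rule arg_cong)
    moreover have "int (n - k) = int n - int k" using Suc.prems by simp
    ultimately show ?thesis
      by (simp only: of_nat_mult of_nat_add of_nat_1 of_nat_numeral mult.assoc)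
  qed
  have B: "?d * ?B' = 4 * (2 * int k + 1)\<^sup>2 * ?B"
  proof -
    have "Suc k * (2 * Suc k choose Suc k) = 2 * Suc k * (2 * k + 1 choose k)"
      using binomial_absorption[of k "2 * Suc k"] by simp
    hence "2 * Suc k choose Suc k = 2 * (2 * k + 1 choose k)"
      by (metis mult.assoc mult.commute mult_cancel1 nat.distinct(1))
    moreover have "(k + 1) * (2 * k + 1 choose k) = (2 * k + 1) * (2 * k choose k)"
      using binomial_absorb_comp[of "2 * k + 1" k] by simp
    moreover have "(2 * k + 1) * (2 * k + 2) * (2 * x) = 4 * (2 * k + 1) * ((k + 1) * x)" for x
      by (simp add: algebra_simps)
    ultimately have "(2 * k + 1) * (2 * k + 2) * (2 * Suc k choose Suc k) =
        4 * (2 * k + 1) * ((2 * k + 1) * (2 * k choose k))" by (simp only:)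
    hence "int ((2 * k + 1) * (2 * k + 2) * (2 * Suc k choose Suc k)) =
        int (4 * (2 * k + 1) * ((2 * k + 1) * (2 * k choose k)))" by (rule arg_cong)
    thus ?thesis
      by (simp only: of_nat_mult of_nat_add of_nat_1 of_nat_numeral mult.assoc power2_eq_square)
  qed
  have p: "4 * ((int n + int k + 1) * (int n - int k)) = (int p)\<^sup>2 - (2 * int k + 1)\<^sup>2"
    using assms(1)[symmetric] by (simp add: power2_eq_square algebra_simps)
  have "?d * (?A' * (-16) ^ Suc k) = (-16) ^ Suc k * (?d * ?A')" by (simp only: mult_ac)
  also have "\<dots> = -4 * (-16) ^ k * (4 * ((int n + int k + 1) * (int n - int k))) * ?A"
    unfolding A by simp
  also have "\<dots> = 4 * (2 * int k + 1)\<^sup>2 * (?A * (-16) ^ k) - (int p)\<^sup>2 * (4 * (-16) ^ k * ?A)"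
    unfolding p by (simp add: algebra_simps)
  also have "[\<dots> = 4 * (2 * int k + 1)\<^sup>2 * ?B - 0] (mod (int p)\<^sup>2)"
    using Suc by (intro cong_diff cong_mult cong_refl Suc.IH) (simp_all add: cong_0_iff)
  also have "4 * (2 * int k + 1)\<^sup>2 * ?B - 0 = ?d * ?B'" using B by simp
  finally have "[?d * (?A' * (-16) ^ Suc k) = ?d * ?B'] (mod (int p)\<^sup>2)" .
  moreover have "coprime ?d ((int p)\<^sup>2)"
  proof -
    have "\<not> int p dvd 2 * int k + 1" "\<not> int p dvd 2 * int k + 2"
      using Suc.prems assms(1) by (auto dest: zdvd_imp_le)
    hence "coprime ?d (int p)"
      by (simp add: coprime_iff prime_dvd_mult_iff[OF prime_int])
    thus ?thesis by simp
  qed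
  ultimately show ?case by (simp only: cong_mult_lcancel)
qed simp

text \<open>Only one of the two central coefficients is replaced. The other turns (n+k choose 2k)
  into (n choose k)(n+k choose k), and -16/32 = -1/2 is the argument for P_n(0).\<close>

lemma sum_choose_square_cong:
  "rat_cong (\<Sum>k=0..(p - 1) div 2. of_nat ((2 * k choose k)\<^sup>2) / 32 ^ k)
     (if even ((p - 1) div 2)
      then (-1) ^ ((p - 1) div 4) * of_nat ((p - 1) div 2 choose ((p - 1) div 4)) / 2 ^ ((p - 1) div 2)
      else 0) ((int p)\<^sup>2)"
proof -
  define n where "n = (p - 1) div 2"
  have n: "2 * n + 1 = p" using odd_p gt_2 by (auto simp: n_def)
  have cop: "coprime (2 ^ k) ((int p)\<^sup>2)" for k
    using odd_p by (simp add: coprime_left_2_iff_odd)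
  have "rat_cong (\<Sum>k=0..n. of_nat ((2 * k choose k)\<^sup>2) / 32 ^ k)
      (\<Sum>k=0..n. of_nat (n choose k) * of_nat (n + k choose k) * (-1/2) ^ k) ((int p)\<^sup>2)"
  proof (rule rat_cong_sum)
    fix k assume "k \<in> {0..n}"
    hence k: "k \<le> n" by simp
    let ?B = "of_nat (2 * k choose k) :: rat"
    have "rat_cong (of_int (int (2 * k choose k))) (of_int (int (n + k choose (2 * k)) * (-16) ^ k)) ((int p)\<^sup>2)"
      by (intro rat_cong_of_int cong_sym[OF choose_central_cong] n k)
    moreover have "integral_at ((int p)\<^sup>2) (?B / of_int (2 ^ (5 * k)))"
      by (intro integral_at_divide_int cop) simp
    ultimately have "rat_cong (?B / of_int (2 ^ (5 * k)) * of_int (int (2 * k choose k)))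
        (?B / of_int (2 ^ (5 * k)) * of_int (int (n + k choose (2 * k)) * (-16) ^ k)) ((int p)\<^sup>2)"
      by (rule rat_cong_scale)
    also have "?B / of_int (2 ^ (5 * k)) * of_int (int (2 * k choose k)) = of_nat ((2 * k choose k)\<^sup>2) / 32 ^ k"
      by (simp add: power_mult power2_eq_square)
    also have "?B / of_int (2 ^ (5 * k)) * of_int (int (n + k choose (2 * k)) * (-16) ^ k) =
        of_nat ((n + k choose (2 * k)) * (2 * k choose k)) * ((-16) ^ k / 32 ^ k)"
      by (simp add: power_mult)
    also have "(n + k choose (2 * k)) * (2 * k choose k) = (n + k choose k) * (n choose k)"
      using choose_mult[of k "2 * k" "n + k"] k by (simp add: mult_2)
    also have "(-16) ^ k / 32 ^ k = (-1/2 :: rat) ^ k"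
      by (simp flip: power_divide)
    finally show "rat_cong (of_nat ((2 * k choose k)\<^sup>2) / 32 ^ k)
        (of_nat (n choose k) * of_nat (n + k choose k) * (-1/2) ^ k) ((int p)\<^sup>2)"
      by (simp add: mult_ac)
  qed
  hence "rat_cong (\<Sum>k=0..n. of_nat ((2 * k choose k)\<^sup>2) / 32 ^ k)
      (if even n then (-1) ^ (n div 2) * of_nat (n choose (n div 2)) / 2 ^ n else 0) ((int p)\<^sup>2)"
    by (simp only: atMost_atLeast0[symmetric] sum_legendre_zero)
  moreover have "n div 2 = (p - 1) div 4" by (simp add: n_def)
  ultimately show ?thesis
    by (simp only: n_def)
qed

end

subsection \<open>Harmonic sums\<close>

text \<open>Both sides are the beta integral of t^x (1-t)^N over [0,1]. The induction step is
  (1-t)^(N+1) = (1-t)^N - t (1-t)^N, the value at x minus the value at x + 1.\<close>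

lemma sum_alternating_choose_divide:
  "(\<Sum>i\<le>N. (-1) ^ i * of_nat (N choose i) / of_nat (x + 1 + i)) =
     (1 / (of_nat (N + 1) * of_nat (N + 1 + x choose x)) :: rat)"
proof (induction N arbitrary: x)
  case 0
  show ?case by (simp add: add.commute)
next
  case (Suc N)
  let ?c = "of_nat (N + 1 + x choose x) :: rat"
  have "(\<Sum>i\<le>Suc N. (-1) ^ i * of_nat (Suc N choose i) / of_nat (x + 1 + i) :: rat) =
      1 / of_nat (x + 1) + (\<Sum>i\<le>N. - ((-1) ^ i * of_nat (Suc N choose Suc i) / of_nat (x + 1 + 1 + i)))"
    by (subst sum.atMost_Suc_shift) simp
  also have "\<dots> = (1 / of_nat (x + 1) + (\<Sum>i\<le>N. - ((-1) ^ i * of_nat (N choose Suc i) / of_nat (x + 1 + 1 + i))))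
      - (\<Sum>i\<le>N. (-1) ^ i * of_nat (N choose i) / of_nat (x + 1 + 1 + i))"
    unfolding add_diff_eq[symmetric] sum_subtractf[symmetric]
    by (intro arg_cong2[where f="(+)"] sum.cong refl)
       (simp add: add_divide_distrib diff_divide_distrib distrib_left)
  also have "1 / of_nat (x + 1) + (\<Sum>i\<le>N. - ((-1) ^ i * of_nat (N choose Suc i) / of_nat (x + 1 + 1 + i))) =
      (\<Sum>i\<le>Suc N. (-1) ^ i * of_nat (N choose i) / of_nat (x + 1 + i) :: rat)"
    by (subst sum.atMost_Suc_shift) simp
  also have "\<dots> = (\<Sum>i\<le>N. (-1) ^ i * of_nat (N choose i) / of_nat (x + 1 + i))"
    by (simp add: binomial_eq_0)
  also have "\<dots> - (\<Sum>i\<le>N. (-1) ^ i * of_nat (N choose i) / of_nat (x + 1 + 1 + i)) =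
      1 / (of_nat (N + 1) * ?c) - 1 / (of_nat (N + 1) * of_nat (N + 1 + (x + 1) choose (x + 1)))"
    by (simp only: Suc.IH)
  also have "of_nat (N + 1 + (x + 1) choose (x + 1)) = (?c * of_nat (N + x + 2) / of_nat (x + 1) :: rat)"
  proof -
    have "(x + 1) * (N + 1 + (x + 1) choose (x + 1)) = (N + x + 2) * (N + 1 + x choose x)"
      using binomial_absorption[of x "N + 1 + (x + 1)"] by simp
    hence "of_nat (x + 1) * of_nat (N + 1 + (x + 1) choose (x + 1)) = (of_nat (N + x + 2) * ?c :: rat)"
      by (metis of_nat_mult)
    moreover have "(of_nat (x + 1) :: rat) \<noteq> 0" by (simp only: of_nat_eq_0_iff)
    ultimately show ?thesis by (simp add: nonzero_eq_divide_eq mult.commute)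
  qed
  also have "1 / (of_nat (N + 1) * ?c) - 1 / (of_nat (N + 1) * (?c * of_nat (N + x + 2) / of_nat (x + 1))) =
      1 / (?c * of_nat (N + x + 2))"
  proof -
    have id: "1 / (a * c) - 1 / (a * (c * (a + b) / b)) = 1 / (c * (a + b))"
      if "a \<noteq> 0" "b \<noteq> 0" "c \<noteq> 0" "a + b \<noteq> 0" for a b c :: rat
      using that by (simp add: divide_simps)
    have nz: "of_nat (N + 1) \<noteq> (0 :: rat)" "of_nat (x + 1) \<noteq> (0 :: rat)"
      "of_nat (N + 1) + of_nat (x + 1) \<noteq> (0 :: rat)" "?c \<noteq> 0"
      by (simp_all only: of_nat_add[symmetric] of_nat_eq_0_iff) (simp_all add: binomial_eq_0_iff)
    have "of_nat (N + x + 2) = (of_nat (N + 1) + of_nat (x + 1) :: rat)" by simp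
    thus ?thesis using id[OF nz(1,2,4,3)] by (simp only:)
  qed
  also have "?c * of_nat (N + x + 2) = of_nat (Suc N + 1) * of_nat (Suc N + 1 + x choose x)"
  proof -
    have "(N + 2) * (N + 2 + x choose x) = (N + x + 2) * (N + 1 + x choose x)"
      using binomial_absorb_comp[of "N + 2 + x" x] by simp
    thus ?thesis by (simp only: of_nat_mult[symmetric]) (simp add: mult.commute)
  qed
  finally show ?case .
qed

definition harm_rat :: "nat \<Rightarrow> rat" where "harm_rat n = (\<Sum>k<n. 1 / of_nat (Suc k))"

definition alt_harm_rat :: "nat \<Rightarrow> rat" where "alt_harm_rat n = (\<Sum>k<n. (-1) ^ k / of_nat (Suc k))"

lemma alt_harm_rat_double: "alt_harm_rat (2 * m) = harm_rat (2 * m) - harm_rat m"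
proof (induction m)
  case (Suc m)
  have "alt_harm_rat (2 * Suc m) =
      alt_harm_rat (2 * m) + 1 / of_nat (Suc (2 * m)) - 1 / of_nat (Suc (Suc (2 * m)))"
    by (simp add: alt_harm_rat_def)
  moreover have "harm_rat (2 * Suc m) =
      harm_rat (2 * m) + 1 / of_nat (Suc (2 * m)) + 1 / of_nat (Suc (Suc (2 * m)))"
    by (simp add: harm_rat_def)
  moreover have "harm_rat (Suc m) = harm_rat m + 2 * (1 / of_nat (Suc (Suc (2 * m))))"
    by (simp add: harm_rat_def field_simps)
  ultimately show ?case using Suc.IH by linarith
qed (simp add: alt_harm_rat_def harm_rat_def)

text \<open>Coefficient of \<open>X\<^sup>r\<close> in \<open>(1 + X)\<^sup>N * ln (1 + X)\<close>, the derivative of \<open>(1 + X)\<^sup>N\<close>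
  with respect to \<open>N\<close>.\<close>

lemma sum_alternating_choose_harm:
  assumes "r \<le> N"
  shows "(\<Sum>k<r. (-1) ^ k * of_nat (N choose (r - Suc k)) / of_nat (Suc k)) =
    of_nat (N choose r) * (harm_rat N - harm_rat (N - r))"
  using assms
proof (induction N arbitrary: r)
  case (Suc N)
  define L :: "nat \<Rightarrow> nat \<Rightarrow> rat"
    where "L N r = (\<Sum>k<r. (-1) ^ k * of_nat (N choose (r - Suc k)) / of_nat (Suc k))" for N r
  show ?case
  proof (cases r)
    case (Suc s)
    have s: "s \<le> N" using Suc Suc.prems by simp
    have "L (Suc N) (Suc s) = L N (Suc s) + L N s"
    proof -
      have "(\<Sum>k<s. (-1) ^ k * of_nat (Suc N choose (s - k)) / of_nat (Suc k) :: rat) =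
        (\<Sum>k<s. (-1) ^ k * of_nat (N choose (s - k)) / of_nat (Suc k)) + L N s"
        unfolding L_def sum.distrib[symmetric]
      proof (rule sum.cong[OF refl])
        fix k assume "k \<in> {..<s}"
        hence "s - k = Suc (s - Suc k)" by auto
        thus "(-1) ^ k * of_nat (Suc N choose (s - k)) / of_nat (Suc k) =
            ((-1) ^ k * of_nat (N choose (s - k)) / of_nat (Suc k) +
             (-1) ^ k * of_nat (N choose (s - Suc k)) / of_nat (Suc k) :: rat)"
          by (simp add: add_divide_distrib distrib_left)
      qed
      thus ?thesis by (simp add: L_def)
    qed
    also have "L N s = of_nat (N choose s) * (harm_rat N - harm_rat (N - s))"
      unfolding L_def by (rule Suc.IH[OF s])
    also have "L N (Suc s) + of_nat (N choose s) * (harm_rat N - harm_rat (N - s)) =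
      of_nat (Suc N choose Suc s) * (harm_rat (Suc N) - harm_rat (N - s))"
    \<comment> \<open>For s = N the index s + 1 exceeds N, outside the induction hypothesis; this
      end term is the beta sum at x = 0.\<close>
    proof (cases "s = N")
      case True
      have "L N (Suc N) = (\<Sum>i\<le>N. (-1) ^ i * of_nat (N choose i) / of_nat (0 + 1 + i))"
        unfolding L_def lessThan_Suc_atMost
        by (intro sum.cong refl) (simp add: binomial_symmetric[symmetric])
      also have "\<dots> = 1 / of_nat (Suc N)"
        by (subst sum_alternating_choose_divide) simp
      finally show ?thesis using True by (simp add: harm_rat_def)
    next
      case False
      with s have sN: "Suc s \<le> N" by simp
      have "L N (Suc s) = of_nat (N choose Suc s) * (harm_rat N - harm_rat (N - Suc s))"
        unfolding L_def by (rule Suc.IH[OF sN])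
      moreover have "harm_rat (N - s) = harm_rat (N - Suc s) + 1 / of_nat (N - s)"
      proof -
        have "N - s = Suc (N - Suc s)" using sN by simp
        thus ?thesis by (simp add: harm_rat_def)
      qed
      moreover have "harm_rat (Suc N) = harm_rat N + 1 / of_nat (Suc N)"
        by (simp add: harm_rat_def)
      \<comment> \<open>This balances the increment 1/(N - s) of one harmonic number against 1/(N +
        1) of the other.\<close>
      moreover have "of_nat (N choose Suc s) / of_nat (N - s) = (of_nat (Suc N choose Suc s) / of_nat (Suc N) :: rat)"
      proof -
        have "Suc s * (N choose Suc s) = (N - s) * (N choose s)"
          by (metis binomial_absorption binomial_absorb_comp)
        moreover have "Suc s * (Suc N choose Suc s) = Suc N * (N choose s)"
          using binomial_absorption[of s "Suc N"] by simp
        ultimately have "Suc s * ((N choose Suc s) * Suc N) = Suc s * ((Suc N choose Suc s) * (N - s))"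
          by (metis mult.assoc mult.commute)
        hence "(N choose Suc s) * Suc N = (Suc N choose Suc s) * (N - s)"
          by (simp only: mult_cancel1) simp
        hence "of_nat (N choose Suc s) * of_nat (Suc N) = (of_nat (Suc N choose Suc s) * of_nat (N - s) :: rat)"
          by (metis of_nat_mult)
        moreover have "of_nat (N - s) \<noteq> (0 :: rat)" "of_nat (Suc N) \<noteq> (0 :: rat)"
          using sN by (simp_all del: of_nat_Suc)
        ultimately show ?thesis by (metis frac_eq_eq)
      qed
      moreover have "of_nat (Suc N choose Suc s) = (of_nat (N choose Suc s) + of_nat (N choose s) :: rat)"
        by simp
      ultimately show ?thesis
        by (simp only:) (simp add: algebra_simps add_divide_distrib)
    qed
    finally show ?thesis using Suc by (simp add: L_def)
  qed simp
qed simp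

section \<open>The row of p in Pascal's triangle and the Fermat quotient of 2\<close>

context odd_prime
begin

text \<open>Neighbours in row p - 1 add up to an entry of row p, which is divisible by p.\<close>

lemma choose_pred_cong: "k < p \<Longrightarrow> [int (p - 1 choose k) = (-1) ^ k] (mod int p)"
proof (induction k)
  case (Suc k)
  have "p choose Suc k = (p - 1 choose k) + (p - 1 choose Suc k)"
    using p_pos by (metis Suc_pred' binomial_Suc_Suc)
  moreover have "p dvd (p choose Suc k)"
    by (intro dvd_choose_prime prime) (use Suc.prems in auto)
  ultimately have "[int (p - 1 choose k) + int (p - 1 choose Suc k) = 0] (mod int p)"
    by (simp add: cong_0_iff flip: of_nat_add)
  from cong_diff[OF this Suc.IH] Suc.prems show ?case by simp
qed simp

text \<open>(p choose r) is p/r times (p-1 choose r-1), and the latter is needed only modulo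
  p.\<close>

lemma choose_prime_rat_cong:
  assumes "0 < r" "r < p"
  shows "rat_cong (of_nat (p choose r)) (of_nat p * ((-1) ^ (r - 1) / of_nat r)) ((int p)\<^sup>2)"
proof -
  have "\<not> int p dvd int r" using assms by (auto dest: dvd_imp_le)
  hence "integral_at (int p) (1 / of_nat r)"
    by (intro integral_at_divide_nat integral_at_1 coprime_iff[THEN iffD2])
  moreover have "rat_cong (of_int (int (p - 1 choose (r - 1)))) (of_int ((-1) ^ (r - 1))) (int p)"
    using assms by (intro rat_cong_of_int choose_pred_cong) auto
  ultimately have "rat_cong (1 / of_nat r * of_int (int (p - 1 choose (r - 1))))
      (1 / of_nat r * of_int ((-1) ^ (r - 1))) (int p)"
    by (intro rat_cong_scale)
  from rat_cong_mult_modulus[OF this]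
  have "rat_cong (of_nat p * (1 / of_nat r * of_int (int (p - 1 choose (r - 1)))))
     (of_nat p * ((-1) ^ (r - 1) / of_nat r)) ((int p)\<^sup>2)" by simp
  also have "of_nat p * (1 / of_nat r * of_int (int (p - 1 choose (r - 1)))) = (of_nat (p choose r) :: rat)"
  proof -
    have "r * (p choose r) = p * (p - 1 choose (r - 1))"
      using assms(1) by (rule times_binomial_minus1_eq)
    hence "of_nat r * of_nat (p choose r) = (of_nat p * of_nat (p - 1 choose (r - 1)) :: rat)"
      by (metis of_nat_mult)
    thus ?thesis using assms(1) by (simp add: field_simps)
  qed
  finally show ?thesis .
qed

lemma integral_at_alt_harm_rat:
  assumes "n < p"
  shows "integral_at (int p) (alt_harm_rat n)"
  unfolding alt_harm_rat_def
proof (rule integral_at_sum)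
  fix k assume "k \<in> {..<n}"
  hence "\<not> int p dvd int (Suc k)" using assms by (auto dest!: dvd_imp_le simp del: of_nat_Suc)
  thus "integral_at (int p) ((-1) ^ k / of_nat (Suc k))"
    by (intro integral_at_divide_nat integral_at_power integral_at_minus integral_at_1
        coprime_iff[THEN iffD2])
qed

text \<open>The Fermat quotient of \<open>2\<close>: expand \<open>(1 + 1)\<^sup>p\<close> and pair \<open>k\<close> with \<open>p - k\<close>.\<close>

lemma alt_harm_rat_cong:
  "rat_cong (of_nat p * alt_harm_rat ((p - 1) div 2)) (2 ^ (p - 1) - 1) ((int p)\<^sup>2)"
proof -
  define n where "n = (p - 1) div 2"
  have n: "p = 2 * n + 1" using odd_p gt_2 by (auto simp: n_def)
  have pair: "rat_cong (alt_harm_rat (n + n)) (2 * alt_harm_rat n) (int p)"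
  proof -
    have "alt_harm_rat (n + n) = alt_harm_rat n + (\<Sum>k<n. (-1) ^ (n + k) / of_nat (Suc (n + k)))"
    proof -
      have "(\<Sum>k<n + l. (-1) ^ k / of_nat (Suc k)) =
          (\<Sum>k<n. (-1) ^ k / of_nat (Suc k)) + (\<Sum>k<l. (-1) ^ (n + k) / of_nat (Suc (n + k)) :: rat)" for l
        by (induction l) simp_all
      thus ?thesis by (simp only: alt_harm_rat_def)
    qed
    \<comment> \<open>Reversing the order turns the denominator n + k + 1 into p minus the new one.
      The exponents n + k and n - 1 - k have opposite parity, which absorbs the minus sign.\<close>
    also have "(\<Sum>k<n. (-1) ^ (n + k) / of_nat (Suc (n + k))) = (\<Sum>k<n. (-1) ^ k / of_int (int (Suc k) - int p) :: rat)"
    proof (rule sum.reindex_bij_witness[of _ "\<lambda>k. n - Suc k" "\<lambda>k. n - Suc k"])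
      fix k assume "k \<in> {..<n}"
      hence k: "k < n" by simp
      hence 1: "(-1 :: rat) ^ (n - Suc k) = - ((-1) ^ (n + k))"
        by (subst minus_one_power_iff)+ auto
      have 2: "of_int (int (Suc (n - Suc k)) - int p) = - (of_nat (Suc (n + k)) :: rat)"
        using k by (simp add: n of_nat_diff)
      show "(-1) ^ (n - Suc k) / of_int (int (Suc (n - Suc k)) - int p) =
          ((-1) ^ (n + k) / of_nat (Suc (n + k)) :: rat)"
        unfolding 1 2 by (rule minus_divide_divide)
    qed auto
    also have "rat_cong (alt_harm_rat n + \<dots>) (alt_harm_rat n + alt_harm_rat n) (int p)"
      unfolding alt_harm_rat_def
    proof (intro rat_cong_add rat_cong_refl rat_cong_sum)
      fix k assume "k \<in> {..<n}"
      hence k: "k < n" by simp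
      have "\<not> int p dvd int (Suc k)" using k n by (auto dest!: dvd_imp_le simp del: of_nat_Suc)
      moreover have "\<not> int p dvd int (Suc k) - int p"
        using calculation by (metis dvd_diff dvd_refl diff_add_cancel dvd_add)
      ultimately have "rat_cong (1 / of_int (int (Suc k) - int p)) (1 / of_int (int (Suc k))) (int p)"
        by (intro rat_cong_inverse_int)
           (auto simp: cong_iff_dvd_diff intro!: coprime_iff[THEN iffD2])
      from rat_cong_scale[OF this, of "(-1) ^ k"]
      show "rat_cong ((-1) ^ k / of_int (int (Suc k) - int p)) ((-1) ^ k / of_nat (Suc k)) (int p)"
        by (simp add: integral_at_power integral_at_minus)
    qed
    finally show ?thesis by simp
  qed
  have "(2 :: nat) ^ p = (\<Sum>k\<le>p. p choose k)" by (rule choose_row_sum[symmetric])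
  also have "\<dots> = 2 + (\<Sum>k<p - 1. p choose Suc k)"
  proof -
    have "(\<Sum>k\<le>Suc q. Suc q choose k) = 2 + (\<Sum>k<q. Suc q choose Suc k)" for q
      unfolding sum.atMost_shift sum.lessThan_Suc by simp
    from this[of "p - 1"] show ?thesis by simp
  qed
  finally have "2 ^ p - 2 = (\<Sum>k<p - 1. of_nat (p choose Suc k) :: rat)"
    by (metis add_diff_cancel_left' of_nat_add of_nat_numeral of_nat_power of_nat_sum)
  also have "rat_cong \<dots> (\<Sum>k<p - 1. of_nat p * ((-1) ^ k / of_nat (Suc k))) ((int p)\<^sup>2)"
  proof (rule rat_cong_sum)
    fix k assume "k \<in> {..<p - 1}"
    thus "rat_cong (of_nat (p choose Suc k)) (of_nat p * ((-1) ^ k / of_nat (Suc k))) ((int p)\<^sup>2)"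
      using choose_prime_rat_cong[of "Suc k"] by auto
  qed
  also have "(\<Sum>k<p - 1. of_nat p * ((-1) ^ k / of_nat (Suc k))) = of_nat p * alt_harm_rat (n + n)"
  proof -
    have "p - 1 = n + n" using n by simp
    thus ?thesis by (simp only: alt_harm_rat_def sum_distrib_left)
  qed
  also have "rat_cong \<dots> (of_nat p * (2 * alt_harm_rat n)) ((int p)\<^sup>2)"
    by (rule rat_cong_mult_modulus[OF pair])
  finally have "rat_cong (2 ^ p - 2) (of_nat p * (2 * alt_harm_rat n)) ((int p)\<^sup>2)" .
  moreover have "integral_at ((int p)\<^sup>2) (1 / of_int 2)"
    using odd_p by (intro integral_at_divide_int) (simp_all add: coprime_left_2_iff_odd)
  ultimately have "rat_cong (1 / of_int 2 * (2 ^ p - 2)) (1 / of_int 2 * (of_nat p * (2 * alt_harm_rat n))) ((int p)\<^sup>2)"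
    by (rule rat_cong_scale)
  moreover have "1 / of_int 2 * (2 ^ p - 2) = (2 ^ (p - 1) - 1 :: rat)"
  proof -
    have "(2 :: rat) ^ p = 2 * 2 ^ (p - 1)" using p_pos by (simp flip: power_Suc)
    thus ?thesis by simp
  qed
  moreover have "1 / of_int 2 * (of_nat p * (2 * alt_harm_rat n)) = of_nat p * alt_harm_rat n"
    by simp
  ultimately show ?thesis unfolding n_def[symmetric] by (simp only: rat_cong_sym)
qed

end

subsection \<open>The central binomial coefficient\<close>

lemma rat_cong_square_modulus: "rat_cong x y (m\<^sup>2) \<Longrightarrow> rat_cong x y m"
proof -
  assume "rat_cong x y (m\<^sup>2)"
  then obtain z where "integral_at (m\<^sup>2) z" "x - y = of_int (m\<^sup>2) * z"
    by (auto simp: rat_cong_iff)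
  thus ?thesis
    unfolding rat_cong_iff
    by (intro exI[of _ "of_int m * z"])
       (simp add: integral_at_power_iff integral_at_mult, simp add: power2_eq_square)
qed

context prime_1_mod_4
begin

abbreviation C :: nat where "C \<equiv> 2 * m choose m"

lemma coprime_int_iff: "coprime (int k) (int p) \<longleftrightarrow> \<not> p dvd k"
  using coprime_iff[of "int k"] by (simp only: int_dvd_int_iff)

lemma not_dvd_central: "\<not> p dvd C"
proof
  assume "p dvd C"
  also have "C dvd fact (2 * m)"
    using binomial_fact_lemma[of m "2 * m"] by (metis dvd_triv_right le_add2 mult_2)
  finally have "p dvd fact (2 * m)" .
  thus False using prime p_eq by (simp add: prime_dvd_fact_iff)
qed

text \<open>Upper negation: (2m+k choose k) is (-1)^k (-2m-1 choose k), and -2m - 1 is 2m modulo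
  p.\<close>

lemma choose_triple_cong: "[(-1) ^ m * int (3 * m choose m) = int C] (mod int p)"
proof -
  have "[int (2 * m + k choose k) = (-1) ^ k * int (2 * m choose k)] (mod int p)" if "k \<le> m" for k
    using that
  proof (induction k)
    case (Suc k)
    have 1: "(k + 1) * (2 * m + Suc k choose Suc k) = (2 * m + k + 1) * (2 * m + k choose k)"
      using binomial_absorption[of k "2 * m + Suc k"] by (simp only: Suc_eq_plus1 add.assoc) simp
    have 2: "(k + 1) * (2 * m choose Suc k) = (2 * m - k) * (2 * m choose k)"
      by (metis Suc_eq_plus1 binomial_absorption binomial_absorb_comp)
    have "int (k + 1) * int (2 * m + Suc k choose Suc k) = int (2 * m + k + 1) * int (2 * m + k choose k)"
      unfolding of_nat_mult[symmetric] 1 ..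
    also have "[int (2 * m + k + 1) * int (2 * m + k choose k) =
        (- int (2 * m - k)) * ((-1) ^ k * int (2 * m choose k))] (mod int p)"
    proof (intro cong_mult Suc.IH)
      have "int (2 * m + k + 1) - (- int (2 * m - k)) = int p" using Suc.prems by (simp add: p_eq of_nat_diff)
      thus "[int (2 * m + k + 1) = - int (2 * m - k)] (mod int p)" by (simp add: cong_iff_dvd_diff)
    qed (use Suc.prems in simp)
    also have "(- int (2 * m - k)) * ((-1) ^ k * int (2 * m choose k)) =
        (-1) ^ Suc k * int ((2 * m - k) * (2 * m choose k))" by simp
    also have "\<dots> = int (k + 1) * ((-1) ^ Suc k * int (2 * m choose Suc k))"
      unfolding 2[symmetric] by (simp add: algebra_simps)
    finally have "[int (k + 1) * int (2 * m + Suc k choose Suc k) =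
        int (k + 1) * ((-1) ^ Suc k * int (2 * m choose Suc k))] (mod int p)" .
    moreover have "coprime (int (k + 1)) (int p)"
    proof (rule coprime_int_iff[THEN iffD2], rule notI)
      assume "p dvd k + 1"
      hence "p \<le> k + 1" by (rule dvd_imp_le) simp
      thus False using Suc.prems p_eq by simp
    qed
    ultimately show ?case by (simp only: cong_mult_lcancel)
  qed simp
  from this[of m] have "[(-1) ^ m * int (2 * m + m choose m) = (-1) ^ m * ((-1) ^ m * int C)] (mod int p)"
    by (intro cong_scalar_left) simp
  moreover have "(-1) ^ m * ((-1) ^ m * int C) = int C"
    by (simp add: mult.assoc[symmetric] power_mult_distrib[symmetric])
  moreover have "2 * m + m = 3 * m" by simp
  ultimately show ?thesis by (simp only:)
qed

text \<open>With (p choose r) replaced by p (-1)^(r-1) / r, the sum is a coefficient of (1+X)^(2m-1)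
  ln(1+X). Its harmonic difference H_(2m-1) - H_(m-1) equals the alternating sum up to 2m plus
  1/(2m).\<close>

lemma first_sum_cong:
  "rat_cong (of_nat (2 * (\<Sum>i<m. 2 * m * (2 * m - 1 choose i) * (p choose (m - i)))))
     (of_nat p * (of_nat C * (2 * of_nat m * alt_harm_rat (2 * m) + 1))) ((int p)\<^sup>2)"
proof -
  define W :: rat where "W = (\<Sum>k<m. (-1) ^ k * of_nat (2 * m - 1 choose (m - Suc k)) / of_nat (Suc k))"
  have W: "4 * of_nat m * W = of_nat C * (2 * of_nat m * alt_harm_rat (2 * m) + 1)"
  proof -
    have "W = of_nat (2 * m - 1 choose m) * (harm_rat (2 * m - 1) - harm_rat (2 * m - 1 - m))"
      unfolding W_def by (rule sum_alternating_choose_harm) (use m_pos in simp)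
    moreover have harm_Suc: "harm_rat (Suc k) = harm_rat k + 1 / of_nat (Suc k)" for k
      by (simp add: harm_rat_def)
    have "Suc (2 * m - 1) = 2 * m" "Suc (2 * m - 1 - m) = m" using m_pos by simp_all
    hence "harm_rat (2 * m) = harm_rat (2 * m - 1) + 1 / of_nat (2 * m)"
      "harm_rat m = harm_rat (2 * m - 1 - m) + 1 / of_nat m"
      using harm_Suc[of "2 * m - 1"] harm_Suc[of "2 * m - 1 - m"] by (simp_all only:)
    ultimately have "W = of_nat (2 * m - 1 choose m) *
        (alt_harm_rat (2 * m) - 1 / of_nat (2 * m) + 1 / of_nat m)"
      unfolding alt_harm_rat_double by simp
    moreover have "of_nat C = (2 * of_nat (2 * m - 1 choose m) :: rat)"
    proof -
      have "m * C = 2 * m * (2 * m - 1 choose (m - 1))"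
        by (rule times_binomial_minus1_eq[OF m_pos])
      hence "C = 2 * (2 * m - 1 choose (m - 1))" using m_pos by simp
      also have "2 * m - 1 choose (m - 1) = 2 * m - 1 choose m"
        using binomial_symmetric[of m "2 * m - 1"] m_pos by simp
      finally show ?thesis by simp
    qed
    ultimately show ?thesis using m_pos by (simp add: field_simps)
  qed
  have "rat_cong (\<Sum>i<m. 4 * of_nat m * of_nat (2 * m - 1 choose i) * of_nat (p choose (m - i)))
      (\<Sum>i<m. 4 * of_nat m * of_nat (2 * m - 1 choose i) * (of_nat p * ((-1) ^ (m - i - 1) / of_nat (m - i)))) ((int p)\<^sup>2)"
  proof (rule rat_cong_sum)
    fix i assume "i \<in> {..<m}"
    thus "rat_cong (4 * of_nat m * of_nat (2 * m - 1 choose i) * of_nat (p choose (m - i)))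
      (4 * of_nat m * of_nat (2 * m - 1 choose i) * (of_nat p * ((-1) ^ (m - i - 1) / of_nat (m - i)))) ((int p)\<^sup>2)"
      by (intro rat_cong_scale choose_prime_rat_cong integral_at_mult) (auto simp: p_eq)
  qed
  also have "(\<Sum>i<m. 4 * of_nat m * of_nat (2 * m - 1 choose i) * (of_nat p * ((-1) ^ (m - i - 1) / of_nat (m - i)))) =
      (\<Sum>k<m. 4 * of_nat m * of_nat p * ((-1) ^ k * of_nat (2 * m - 1 choose (m - Suc k)) / of_nat (Suc k) :: rat))"
  proof (rule sum.reindex_bij_witness[of _ "\<lambda>k. m - Suc k" "\<lambda>k. m - Suc k"])
    fix i assume "i \<in> {..<m}"
    hence "m - (m - Suc i) = Suc i" "m - i = Suc (m - Suc i)" "m - Suc (m - Suc i) = i" "m - i - 1 = m - Suc i" by auto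
    thus "4 * of_nat m * of_nat p * ((-1) ^ (m - Suc i) * of_nat (2 * m - 1 choose (m - Suc (m - Suc i))) / of_nat (Suc (m - Suc i))) =
        (4 * of_nat m * of_nat (2 * m - 1 choose i) * (of_nat p * ((-1) ^ (m - i - 1) / of_nat (m - i))) :: rat)"
      by (simp only:) (simp add: mult_ac)
  qed auto
  also have "\<dots> = of_nat p * (4 * of_nat m * W)"
    unfolding W_def by (simp only: sum_distrib_left mult_ac)
  also have "\<dots> = of_nat p * (of_nat C * (2 * of_nat m * alt_harm_rat (2 * m) + 1))"
    by (simp only: W)
  finally show ?thesis
    by (simp add: sum_distrib_left mult_ac)
qed

text \<open>After reversal the denominators are m + 1 + i, so the beta sum applies with N = 2m - 1
  and x = m. It yields 1/(3m choose m), reduced to 1/C by \<open>choose_triple_cong\<close>.\<close>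

lemma second_sum_cong:
  "rat_cong (of_nat (\<Sum>i<2 * m. 2 * m * (2 * m - 1 choose i) * (p choose (3 * m - i))))
     (of_nat p * (1 / of_nat C)) ((int p)\<^sup>2)"
proof -
  define W :: rat where "W = (\<Sum>i\<le>2 * m - 1. (-1) ^ i * of_nat (2 * m - 1 choose i) / of_nat (m + 1 + i))"
  have W: "2 * of_nat m * W = 1 / of_nat (3 * m choose m)"
  proof -
    have "2 * m - 1 + 1 = 2 * m" "2 * m - 1 + 1 + m = 3 * m" using m_pos by simp_all
    thus ?thesis
      unfolding W_def sum_alternating_choose_divide using m_pos by simp
  qed
  have "rat_cong (\<Sum>i<2 * m. 2 * of_nat m * of_nat (2 * m - 1 choose i) * of_nat (p choose (3 * m - i)))
      (\<Sum>i<2 * m. 2 * of_nat m * of_nat (2 * m - 1 choose i) * (of_nat p * ((-1) ^ (3 * m - i - 1) / of_nat (3 * m - i)))) ((int p)\<^sup>2)"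
  proof (rule rat_cong_sum)
    fix i assume "i \<in> {..<2 * m}"
    thus "rat_cong (2 * of_nat m * of_nat (2 * m - 1 choose i) * of_nat (p choose (3 * m - i)))
      (2 * of_nat m * of_nat (2 * m - 1 choose i) * (of_nat p * ((-1) ^ (3 * m - i - 1) / of_nat (3 * m - i)))) ((int p)\<^sup>2)"
      by (intro rat_cong_scale choose_prime_rat_cong integral_at_mult) (auto simp: p_eq)
  qed
  also have "(\<Sum>i<2 * m. 2 * of_nat m * of_nat (2 * m - 1 choose i) * (of_nat p * ((-1) ^ (3 * m - i - 1) / of_nat (3 * m - i)))) =
      (\<Sum>i\<le>2 * m - 1. of_nat p * ((-1) ^ m * (2 * of_nat m * ((-1) ^ i * of_nat (2 * m - 1 choose i) / of_nat (m + 1 + i)))) :: rat)"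
  proof (rule sum.reindex_bij_witness[of _ "\<lambda>i. 2 * m - 1 - i" "\<lambda>i. 2 * m - 1 - i"])
    fix i assume "i \<in> {..<2 * m}"
    hence i: "i < 2 * m" by simp
    have "2 * m - 1 choose (2 * m - 1 - i) = 2 * m - 1 choose i"
      using i by (intro binomial_symmetric[symmetric]) simp
    moreover have "m + 1 + (2 * m - 1 - i) = 3 * m - i" using i by simp
    moreover have "(-1 :: rat) ^ m * (-1) ^ (2 * m - 1 - i) = (-1) ^ (3 * m - i - 1)"
    proof -
      have "m + (2 * m - 1 - i) = 3 * m - i - 1" using i by simp
      thus ?thesis by (simp only: power_add[symmetric])
    qed
    ultimately show "of_nat p * ((-1) ^ m * (2 * of_nat m * ((-1) ^ (2 * m - 1 - i) * of_nat (2 * m - 1 choose (2 * m - 1 - i)) / of_nat (m + 1 + (2 * m - 1 - i))))) =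
        (2 * of_nat m * of_nat (2 * m - 1 choose i) * (of_nat p * ((-1) ^ (3 * m - i - 1) / of_nat (3 * m - i))) :: rat)"
      by (simp only: mult.assoc[symmetric] times_divide_eq_right) (simp only: mult_ac)
  qed (use m_pos in auto)
  also have "\<dots> = of_nat p * ((-1) ^ m * (2 * of_nat m * W))"
    unfolding W_def by (simp only: sum_distrib_left)
  also have "\<dots> = of_nat p * (1 / of_int ((-1) ^ m * int (3 * m choose m)))"
    unfolding W by (cases "even m") simp_all
  also have "rat_cong \<dots> (of_nat p * (1 / of_int (int C))) ((int p)\<^sup>2)"
  proof (intro rat_cong_mult_modulus rat_cong_inverse_int choose_triple_cong)
    have "coprime (int C) (int p)" using not_dvd_central by (rule coprime_int_iff[THEN iffD2])
    thus "coprime ((-1) ^ m * int (3 * m choose m)) (int p)"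
      using choose_triple_cong by (metis cong_imp_coprime cong_sym)
  qed (simp_all add: binomial_eq_0_iff)
  finally show ?thesis by (simp add: mult_ac)
qed

text \<open>The theorem of Chowla, Dwork and Evans; the Fermat quotient of \<open>2\<close> in its usual form is
  absorbed into the factor \<open>(-1)\<^sup>m / 4\<^sup>m\<close>.\<close>

theorem central_choose_cong:
  fixes a b :: int
  assumes ab: "int p = a\<^sup>2 + b\<^sup>2" and a: "4 dvd a - 1"
  shows "rat_cong ((-1) ^ m * of_nat C / 4 ^ m) (2 * of_int a - of_nat p / (2 * of_int a)) ((int p)\<^sup>2)"
proof -
  let ?P = "of_nat p :: rat" and ?c = "of_nat C :: rat" and ?M = "(int p)\<^sup>2"
  define h where "h = alt_harm_rat (2 * m)"
  \<comment> \<open>A square root of 2^(p-1) that is 1 modulo p. Hence (w^2 - 1)/2 is w - 1 modulo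
    p^2, and the Fermat quotient enters linearly.\<close>
  define w :: int where "w = (-1) ^ m * 4 ^ m"
  have ih: "integral_at (int p) h"
    unfolding h_def using p_eq by (intro integral_at_alt_harm_rat) simp
  have cop_C: "coprime (int C) (int p)" using not_dvd_central by (rule coprime_int_iff[THEN iffD2])
  have C0: "?c \<noteq> 0" by (simp add: binomial_eq_0_iff)
  have iC: "integral_at (int p) (1 / ?c)"
    using cop_C by (intro integral_at_divide_nat) simp_all
  have M: "integral_at ?M x \<longleftrightarrow> integral_at (int p) x" for x
    by (rule integral_at_power_iff) simp
  have w1: "[w = 1] (mod int p)"
  proof -
    have "[w = (-1) ^ m * (-1) ^ m] (mod int p)"
      unfolding w_def by (intro cong_scalar_left four_power_cong)
    thus ?thesis by (simp add: power_mult_distrib[symmetric])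
  qed
  then obtain t where t: "w - 1 = int p * t" by (auto simp: cong_iff_dvd_diff elim: dvdE)
  have wt: "of_int w = 1 + ?P * of_int t"
    by (metis t add.commute diff_add_cancel of_int_1 of_int_add of_int_mult of_int_of_nat_eq)
  have w2: "w\<^sup>2 = 2 ^ (p - 1)"
  proof -
    have "w\<^sup>2 = ((-1) ^ m)\<^sup>2 * (2 ^ (2 * m))\<^sup>2" by (simp add: w_def power_mult_distrib power_mult)
    thus ?thesis by (simp add: p_eq flip: power_mult)
  qed
  have w_cop: "coprime w (int p)"
    using w1 by (metis cong_imp_coprime cong_sym coprime_1_left)
  have w0: "of_int w \<noteq> (0 :: rat)" by (simp add: w_def)

  let ?S = "\<Sum>k<p. 2 * m * p choose (m + 2 * m * k)"
  have "rat_cong (of_nat ?S) (?c + ?P * (?c * (2 * of_nat m * h + 1)) + ?P * (1 / ?c)) ?M"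
  proof -
    have "rat_cong (of_nat ?S) (of_nat (C + 2 * (\<Sum>i<m. 2 * m * (2 * m - 1 choose i) * (p choose (m - i)))
      + (\<Sum>i<2 * m. 2 * m * (2 * m - 1 choose i) * (p choose (3 * m - i))))) (int (p\<^sup>2))"
      by (rule rat_cong_of_nat[OF sum_choose_cong])
    also have "rat_cong (of_nat (C + 2 * (\<Sum>i<m. 2 * m * (2 * m - 1 choose i) * (p choose (m - i)))
      + (\<Sum>i<2 * m. 2 * m * (2 * m - 1 choose i) * (p choose (3 * m - i)))))
      (?c + ?P * (?c * (2 * of_nat m * h + 1)) + ?P * (1 / ?c)) (int (p\<^sup>2))"
      unfolding of_nat_add[where 'a = rat] h_def of_nat_power
      by (intro rat_cong_add rat_cong_refl first_sum_cong second_sum_cong)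
    finally show ?thesis by (simp only: of_nat_power)
  qed
  hence "rat_cong (of_int (- (4 * int m)) * of_nat ?S)
      (of_int (- (4 * int m)) * (?c + ?P * (?c * (2 * of_nat m * h + 1)) + ?P * (1 / ?c))) ?M"
    by (rule rat_cong_scale) (rule integral_at_of_int)
  moreover have "rat_cong (2 * of_int a) (of_int (- (4 * int m)) * of_nat ?S) ?M"
  proof -
    have "[(- ((-1) ^ m)) * (- ((-1) ^ m) * (2 * a)) =
        (- ((-1) ^ m)) * (4 * int m * (-1) ^ m * int ?S)] (mod ?M)"
      using jacobsthal_1_cong_choose unfolding jacobsthal_1[OF ab a] by (rule cong_scalar_left)
    moreover have "(- ((-1) ^ m)) * (- ((-1) ^ m) * (2 * a)) = 2 * a" by (cases "even m") simp_all
    moreover have "(- ((-1) ^ m)) * (4 * int m * (-1) ^ m * int ?S) = - (4 * int m) * int ?S"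
      by (cases "even m") simp_all
    ultimately have "[2 * a = - (4 * int m) * int ?S] (mod ?M)" by (simp only:)
    from rat_cong_of_int[OF this] show ?thesis
      by (simp only: of_int_mult of_int_numeral of_int_of_nat_eq)
  qed
  ultimately have "rat_cong (2 * of_int a)
      (of_int (- (4 * int m)) * (?c + ?P * (?c * (2 * of_nat m * h + 1)) + ?P * (1 / ?c))) ?M"
    by (rule rat_cong_trans[rotated])
  \<comment> \<open>The factor -4m is 1 - p: its p cancels the summand 1 inside the bracket, and p
    times 2m is -p/2 modulo p^2.\<close>
  also have "rat_cong (of_int (- (4 * int m)) * (?c + ?P * (?c * (2 * of_nat m * h + 1)) + ?P * (1 / ?c)))
      (?c - ?c / 2 * (?P * h) + ?P * (1 / ?c)) ?M"
    unfolding rat_cong_iff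
  proof (intro exI conjI)
    show "integral_at ?M (?c * h / of_int 2 - ?c * (2 * of_nat m * h + 1) - 1 / ?c)"
      unfolding M using odd_p
      by (intro integral_at_diff integral_at_mult integral_at_add integral_at_divide_int ih iC)
         (simp_all add: coprime_left_2_iff_odd)
    have id: "(- (4 * x)) * (c + P * (c * (2 * x * h + 1)) + P * d) - (c - c / 2 * (P * h) + P * d) =
        P\<^sup>2 * (c * h / 2 - c * (2 * x * h + 1) - d)" if "P = 4 * x + 1" for P x c d :: rat
      unfolding that by (simp add: power2_eq_square algebra_simps)
    have "?P = 4 * of_nat m + 1" by (simp add: p_eq)
    from id[OF this, of ?c "1 / ?c"] show "of_int (- (4 * int m)) * (?c + ?P * (?c * (2 * of_nat m * h + 1)) + ?P * (1 / ?c))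
        - (?c - ?c / 2 * (?P * h) + ?P * (1 / ?c)) =
        of_int ?M * (?c * h / of_int 2 - ?c * (2 * of_nat m * h + 1) - 1 / ?c)"
      by simp
  qed
  also have "rat_cong (?c - ?c / 2 * (?P * h) + ?P * (1 / ?c))
      (?c - ?c / 2 * ((of_int w)\<^sup>2 - 1) + ?P * (1 / ?c)) ?M"
  proof (rule rat_cong_add[OF rat_cong_diff[OF rat_cong_refl rat_cong_scale] rat_cong_refl])
    have "(p - 1) div 2 = 2 * m" using p_eq by simp
    moreover have "(of_int w)\<^sup>2 = (2 ^ (p - 1) :: rat)"
      using arg_cong[OF w2, of "of_int :: int \<Rightarrow> rat"] by simp
    ultimately show "rat_cong (?P * h) ((of_int w)\<^sup>2 - 1) ?M"
      using alt_harm_rat_cong by (simp only: h_def)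
    show "integral_at ?M (?c / 2)"
      unfolding M using odd_p integral_at_divide_int[of "int p" ?c 2]
      by (simp add: coprime_left_2_iff_odd)
  qed
  \<comment> \<open>With w = 1 + p t, half of w^2 - 1 exceeds w - 1 by p^2 t^2 / 2; this gives the
    witness.\<close>
  also have "rat_cong (?c - ?c / 2 * ((of_int w)\<^sup>2 - 1) + ?P * (1 / ?c))
      (?c * (2 - of_int w) + ?P * (1 / ?c)) ?M"
    unfolding rat_cong_iff
  proof (intro exI conjI)
    show "integral_at ?M (- ?c * (of_int t)\<^sup>2 / of_int 2)"
      unfolding M using odd_p
      by (intro integral_at_divide_int integral_at_mult integral_at_minus integral_at_power)
         (simp_all add: coprime_left_2_iff_odd)
    show "?c - ?c / 2 * ((of_int w)\<^sup>2 - 1) + ?P * (1 / ?c) - (?c * (2 - of_int w) + ?P * (1 / ?c)) =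
        of_int ?M * (- ?c * (of_int t)\<^sup>2 / of_int 2)"
      unfolding wt by (simp add: field_simps power2_eq_square)
  qed
  finally have main: "rat_cong (2 * of_int a) (?c * (2 - of_int w) + ?P * (1 / ?c)) ?M" .

  \<comment> \<open>The weaker congruence modulo p identifies C with 2a, which suffices inside the
    term p / C.\<close>
  have "rat_cong (2 * of_int a) ?c (int p)"
  proof -
    have "rat_cong (?c * (2 - of_int w) + ?P * (1 / ?c)) ?c (int p)"
      unfolding rat_cong_iff
    proof (intro exI conjI)
      show "integral_at (int p) (1 / ?c - ?c * of_int t)"
        by (intro integral_at_diff iC integral_at_mult) simp_all
      show "?c * (2 - of_int w) + ?P * (1 / ?c) - ?c = of_int (int p) * (1 / ?c - ?c * of_int t)"
        unfolding wt by (simp add: algebra_simps)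
    qed
    with rat_cong_square_modulus[OF main] show ?thesis by (rule rat_cong_trans)
  qed
  moreover have "coprime (2 * a) (int p)"
  proof -
    have "\<not> int p dvd a"
    proof
      assume "int p dvd a"
      hence pa: "(int p)\<^sup>2 dvd a\<^sup>2" by simp
      hence "int p dvd a\<^sup>2" using \<open>int p dvd a\<close> by (simp add: power2_eq_square)
      hence "int p dvd b\<^sup>2" using ab by (metis dvd_add_right_iff dvd_refl)
      hence "int p dvd b" using prime_int by (rule prime_dvd_power[rotated])
      hence "(int p)\<^sup>2 dvd b\<^sup>2" by simp
      with pa have "(int p)\<^sup>2 dvd int p" unfolding ab[symmetric] using ab by (metis dvd_add)
      hence "(int p)\<^sup>2 \<le> int p" by (rule zdvd_imp_le) simp
      thus False using gt_2 by (simp add: power2_eq_square)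
    qed
    hence "coprime a (int p)" by (rule coprime_iff[THEN iffD2])
    thus ?thesis using odd_p by (simp add: coprime_left_2_iff_odd)
  qed
  moreover have a0: "of_int a \<noteq> (0 :: rat)" using a by auto
  ultimately have inv: "rat_cong (1 / ?c) (1 / (2 * of_int a)) (int p)"
  proof -
    assume r: "rat_cong (2 * of_int a) ?c (int p)" and "coprime (2 * a) (int p)"
    hence "integral_at (int p) (1 / ?c / of_int (2 * a))"
      by (intro integral_at_divide_int iC)
    from rat_cong_scale[OF r this] show ?thesis using C0 a0 by simp
  qed
  \<comment> \<open>2 - w inverts w modulo p^2, since 1/w - (2 - w) = (w - 1)^2 / w.\<close>
  have "rat_cong (?c / of_int w) (?c * (2 - of_int w)) ?M"
    unfolding rat_cong_iff
  proof (intro exI conjI)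
    show "integral_at ?M (?c * (of_int t)\<^sup>2 / of_int w)"
      unfolding M using w_cop by (intro integral_at_divide_int integral_at_mult integral_at_power) simp_all
    have "?c / of_int w - ?c * (2 - of_int w) = ?c * (of_int w - 1)\<^sup>2 / of_int w"
      using w0 by (simp add: field_simps power2_eq_square)
    thus "?c / of_int w - ?c * (2 - of_int w) = of_int ?M * (?c * (of_int t)\<^sup>2 / of_int w)"
      using wt by (simp add: power_mult_distrib)
  qed
  also have "rat_cong (?c * (2 - of_int w)) (2 * of_int a - ?P * (1 / ?c)) ?M"
    using rat_cong_diff[OF main rat_cong_refl[of "?P * (1 / ?c)"]] by (simp add: rat_cong_sym)
  also have "rat_cong (2 * of_int a - ?P * (1 / ?c)) (2 * of_int a - ?P * (1 / (2 * of_int a))) ?M"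
    by (intro rat_cong_diff rat_cong_refl rat_cong_mult_modulus inv)
  also have "?c / of_int w = (-1) ^ m * ?c / 4 ^ m"
    by (cases "even m") (simp_all add: w_def)
  finally show ?thesis by simp
qed

end

theorem theorem2p2:
  fixes p :: nat
  assumes "prime p" and "odd p"
  shows "(p mod 4 = 3 \<longrightarrow>
            rat_cong (\<Sum>k=0..(p-1) div 2. of_nat ((2*k choose k)^2) / 32^k) 0 (int p ^ 2))
       \<and> (\<forall>a b :: int. p mod 4 = 1 \<longrightarrow> int p = a^2 + b^2 \<longrightarrow> (4::int) dvd (a - 1) \<longrightarrow>
            rat_cong (\<Sum>k=0..(p-1) div 2. of_nat ((2*k choose k)^2) / 32^k)
                     (2 * of_int a - of_nat p / (2 * of_int a)) (int p ^ 2))"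
proof (intro conjI impI allI)
  have "2 < p" using assms prime_ge_2_nat[of p] by (cases "p = 2") auto
  with assms(1) interpret odd_prime p by unfold_locales
  {
    assume "p mod 4 = 3"
    hence "odd ((p - 1) div 2)" by presburger
    with sum_choose_square_cong
    show "rat_cong (\<Sum>k=0..(p-1) div 2. of_nat ((2*k choose k)^2) / 32^k) 0 (int p ^ 2)"
      by (simp only: if_False)
  next
    fix a b :: int
    assume p4: "p mod 4 = 1" and ab: "int p = a\<^sup>2 + b\<^sup>2" "4 dvd a - 1"
    define m where "m = (p - 1) div 4"
    have m: "p = 4 * m + 1" using p4 unfolding m_def by presburger
    interpret prime_1_mod_4 p m using assms(1) m by unfold_locales
    have "even ((p - 1) div 2)" and 2: "(p - 1) div 2 = 2 * m" using m by simp_all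
    have 4: "(2 :: rat) ^ (2 * m) = 4 ^ m" by (simp add: power_mult)
    have "rat_cong (\<Sum>k=0..(p-1) div 2. of_nat ((2*k choose k)^2) / 32^k)
        ((-1) ^ m * of_nat (2 * m choose m) / 4 ^ m) ((int p)\<^sup>2)"
      using sum_choose_square_cong \<open>even ((p - 1) div 2)\<close>
      by (simp only: if_True m_def[symmetric] 2 4)
    thus "rat_cong (\<Sum>k=0..(p-1) div 2. of_nat ((2*k choose k)^2) / 32^k)
        (2 * of_int a - of_nat p / (2 * of_int a)) (int p ^ 2)"
      by (rule rat_cong_trans[OF _ central_choose_cong[OF ab]])
  }
qed

end
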